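(* Let $C$ be a chord diagram whose interlace graph $G$ is Gaussian, and let $b_0$ be the number of connected components of $G$. Then $C$ admits exactly $\operatorname{Card}H_0(G;\mathbb{Z}/2)=2^{b_0}$ framings of genus $0$. Two of them are obtained by integrating the Rosenstiehl form: choose a colouring $\chi\colon V_G\to\{\bullet,\circ\}$ such that for every edge $\{x,y\}$ of $G$ one has $\chi(x)\neq\chi(y)$ if and only if $\mathfrak{r}(x,y)=1$; then take the two framings $\varphi\colon C\to\{\infty,0\}$ (exchanged by global inversion of $0$ and $\infty$) such that consecutive letters of the cyclic word $C$ have the same framing if and only if they have different colours. The other framings of genus $0$ differ from these by locally constant changes of framing, that is by inverting the framing of all chords belonging to some union of connected components of $G$.
   Context: A chord diagram is a finite cyclic word $C$ in which every letter appears exactly twice, considered up to relabelling; its letters are called chords. A framing of $C$ is a function $\varphi\colon C\to\{0,\infty\}$ giving different values to the two occurrences of each letter; the occurrences of $x$ are then denoted $x_0,x_\infty$. Two chords are interlaced if their occurrences alternate along the cyclic word. The interlace graph $G$ of $C$ has vertex set $V_G$ the set of chords and edges the pairs of interlaced chords. Graphs are finite and simple, with symmetric adjacency matrix $\mathfrak{e}\colon V_G\times V_G\to\{0,1\}$, zero on the diagonal. A filoop is a generic immersion $\gamma\colon\mathbb{S}^1\to F$ (all multiple points are transverse double points) in a smooth closed connected oriented surface such that $F\setminus\gamma$ is a disjoint union of discs, up to orientation preserving diffeomorphisms of source and target. Each double point $x$ has two preimages $x_\infty,x_0$ ordered so that $(\vec\gamma(x_\infty),\vec\gamma(x_0))$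 (tangent vectors) is a positive basis of $T_xF$; reading the preimages along $\mathbb{S}^1$ gives a framed chord diagram. Every framed chord diagram arises from a unique filoop: take for each chord $x$ an oriented disc with four disjoint boundary intervals labelled $x_\infty^+,x_0^+,x_\infty^-,x_0^-$ in this cyclic order; for every pair of consecutive occurrences $u,v$ in $C$ join $u^+$ to $v^-$ by an orientation-compatible band; glue discs to all boundary components to obtain $F$. The genus of the framing is the genus $g$ of $F$; if $C$ has $n$ chords and the ribbon graph has $f$ boundary components then $2-2g=f-n$. The Rosenstiehl form is $\mathfrak{r}=\mathfrak{e}+\mathfrak{e}^2\colon V_G\times V_G\to\mathbb{Z}/2$. The graph $G$ is Gaussian when: (EN1) every vertex has even degree; (EN2) any two distinct non-adjacent vertices have an even number of common neighbours; (RC) the restriction of $\mathfrak{r}$ to the edges is a coboundary, i.e. lies in $B^1(G;\mathbb{Z}/2)$; equivalently the sum of $\mathfrak{r}$ over the edges of any closed walk in $G$ vanishes modulo $2$. *)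

theory Defs
  imports Main "HOL-Library.FuncSet" "HOL-Library.Z2" "HOL-Combinatorics.Orbits"
begin

text \<open>
  A graph is a finite vertex set \<open>V\<close> together with a set \<open>E\<close> of two-element subsets of \<open>V\<close>.
  Coefficients are taken in the field \<open>bit\<close> with two elements.
\<close>

definition adjacency :: "'a set set \<Rightarrow> 'a \<Rightarrow> 'a \<Rightarrow> bit" where
  "adjacency E x y = (if {x, y} \<in> E then 1 else 0)"

definition rosenstiehl :: "'a set \<Rightarrow> 'a set set \<Rightarrow> 'a \<Rightarrow> 'a \<Rightarrow> bit" where
  "rosenstiehl V E x y = adjacency E x y + (\<Sum>z\<in>V. adjacency E x z * adjacency E z y)"

text \<open>
  A 1-cochain is given by its values \<open>c x y\<close> on the edges \<open>{x, y}\<close>; modulo 2 the coboundary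
  of a 0-cochain \<open>f\<close> takes the value \<open>f x + f y\<close> on \<open>{x, y}\<close>.
\<close>

definition is_coboundary :: "'a set \<Rightarrow> 'a set set \<Rightarrow> ('a \<Rightarrow> 'a \<Rightarrow> bit) \<Rightarrow> bool" where
  "is_coboundary V E c \<longleftrightarrow>
     (\<exists>f :: 'a \<Rightarrow> bit. \<forall>x\<in>V. \<forall>y\<in>V. {x, y} \<in> E \<longrightarrow> c x y = f x + f y)"

definition gaussian :: "'a set \<Rightarrow> 'a set set \<Rightarrow> bool" where
  "gaussian V E \<longleftrightarrow>
     (\<forall>x\<in>V. even (card {y \<in> V. {x, y} \<in> E})) \<and>
     (\<forall>x\<in>V. \<forall>y\<in>V. x \<noteq> y \<and> {x, y} \<notin> E \<longrightarrow>
        even (card {z \<in> V. {x, z} \<in> E \<and> {y, z} \<in> E})) \<and>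
     is_coboundary V E (rosenstiehl V E)"

definition components :: "'a set \<Rightarrow> 'a set set \<Rightarrow> 'a set set" where
  "components V E = V // {(x, y). x \<in> V \<and> y \<in> V \<and> (x, y) \<in> {(u, v). {u, v} \<in> E}\<^sup>*}"

definition chains :: "'b set \<Rightarrow> ('b \<Rightarrow> bit) set" where
  "chains A = {c. \<forall>x. x \<notin> A \<longrightarrow> c x = 0}"

definition boundary :: "'a set set \<Rightarrow> ('a set \<Rightarrow> bit) \<Rightarrow> 'a \<Rightarrow> bit" where
  "boundary E s x = (\<Sum>e\<in>{e \<in> E. x \<in> e}. s e)"

text \<open>The underlying set of $H_0(G;\mathbb{Z}/2)$: 0-chains modulo boundaries of 1-chains.\<close>

definition H0 :: "'a set \<Rightarrow> 'a set set \<Rightarrow> ('a \<Rightarrow> bit) set set" where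
  "H0 V E = chains V //
     {(c, d). c \<in> chains V \<and> d \<in> chains V \<and>
        (\<exists>s\<in>chains E. \<forall>x. d x - c x = boundary E s x)}"

text \<open>
  A cyclic word is represented by a list \<open>w\<close>, read cyclically; position \<open>i\<close> is followed by
  position \<open>Suc i mod length w\<close>. The chords are the elements of \<open>set w\<close>.
\<close>

definition chord_diagram :: "'a list \<Rightarrow> bool" where
  "chord_diagram w \<longleftrightarrow> (\<forall>x\<in>set w. count_list w x = 2)"

definition interlaced :: "'a list \<Rightarrow> 'a \<Rightarrow> 'a \<Rightarrow> bool" where
  "interlaced w x y \<longleftrightarrow> x \<noteq> y \<and>
     (\<exists>i j k l. i < j \<and> j < k \<and> k < l \<and> l < length w \<and>
        (w ! i = x \<and> w ! j = y \<and> w ! k = x \<and> w ! l = y \<or>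
         w ! i = y \<and> w ! j = x \<and> w ! k = y \<and> w ! l = x))"

definition interlace_edges :: "'a list \<Rightarrow> 'a set set" where
  "interlace_edges w = {{x, y} | x y. interlaced w x y}"

datatype frame = Zero | Infinity

fun opposite :: "frame \<Rightarrow> frame" where
  "opposite Zero = Infinity"
| "opposite Infinity = Zero"

text \<open>
  A framing is a function on the positions of the word, extended by \<open>undefined\<close> elsewhere
  so that framings can be counted.
\<close>

definition framings :: "'a list \<Rightarrow> (nat \<Rightarrow> frame) set" where
  "framings w = {\<phi> \<in> {..<length w} \<rightarrow>\<^sub>E UNIV.
     \<forall>i<length w. \<forall>j<length w. i \<noteq> j \<and> w ! i = w ! j \<longrightarrow> \<phi> i \<noteq> \<phi> j}"

definition invert_on :: "'a list \<Rightarrow> 'a set \<Rightarrow> (nat \<Rightarrow> frame) \<Rightarrow> nat \<Rightarrow> frame" where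
  "invert_on w U \<phi> = (\<lambda>i\<in>{..<length w}. if w ! i \<in> U then opposite (\<phi> i) else \<phi> i)"

definition other_occurrence :: "'a list \<Rightarrow> nat \<Rightarrow> nat" where
  "other_occurrence w i = (THE j. j < length w \<and> j \<noteq> i \<and> w ! j = w ! i)"

text \<open>
  \<open>Plus i\<close> and \<open>Minus i\<close> are the intervals $u^+$ and $u^-$ on the boundary of the disc of the
  chord \<open>w ! i\<close>, where $u$ is the occurrence at position \<open>i\<close>.
\<close>

datatype interval = Plus nat | Minus nat

definition intervals :: "'a list \<Rightarrow> interval set" where
  "intervals w = Plus ` {..<length w} \<union> Minus ` {..<length w}"

text \<open>The cyclic order $x_\infty^+, x_0^+, x_\infty^-, x_0^-$ around each disc.\<close>

fun next_on_disc :: "'a list \<Rightarrow> (nat \<Rightarrow> frame) \<Rightarrow> interval \<Rightarrow> interval" where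
  "next_on_disc w \<phi> (Plus i) =
     (case \<phi> i of Infinity \<Rightarrow> Plus (other_occurrence w i) | Zero \<Rightarrow> Minus (other_occurrence w i))"
| "next_on_disc w \<phi> (Minus i) =
     (case \<phi> i of Infinity \<Rightarrow> Minus (other_occurrence w i) | Zero \<Rightarrow> Plus (other_occurrence w i))"

text \<open>The bands join $u^+$ to $v^-$ whenever $v$ follows $u$.\<close>

fun across_band :: "'a list \<Rightarrow> interval \<Rightarrow> interval" where
  "across_band w (Plus i) = Minus (Suc i mod length w)"
| "across_band w (Minus i) = Plus ((i + length w - 1) mod length w)"

text \<open>
  Since the bands respect the orientations, a boundary component of the ribbon graph alternately
  runs along the side of a band and along the arc of a disc from an interval to the next one.
  The boundary components are thus the orbits of \<open>next_on_disc w \<phi> \<circ> across_band w\<close>. The ribbon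
  graph of the empty word is an annulus, which has no disc but two boundary components.
\<close>

definition boundary_components :: "'a list \<Rightarrow> (nat \<Rightarrow> frame) \<Rightarrow> nat" where
  "boundary_components w \<phi> =
     (if w = [] then 2
      else card (orbit (next_on_disc w \<phi> \<circ> across_band w) ` intervals w))"

definition has_genus :: "'a list \<Rightarrow> (nat \<Rightarrow> frame) \<Rightarrow> nat \<Rightarrow> bool" where
  "has_genus w \<phi> g \<longleftrightarrow>
     2 - 2 * int g = int (boundary_components w \<phi>) - int (card (set w))"

definition genus0_framings :: "'a list \<Rightarrow> (nat \<Rightarrow> frame) set" where
  "genus0_framings w = {\<phi> \<in> framings w. has_genus w \<phi> 0}"

datatype colour = Black | White

definition integrates_rosenstiehl :: "'a set \<Rightarrow> 'a set set \<Rightarrow> ('a \<Rightarrow> colour) \<Rightarrow> bool" where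
  "integrates_rosenstiehl V E \<chi> \<longleftrightarrow>
     (\<forall>x\<in>V. \<forall>y\<in>V. {x, y} \<in> E \<longrightarrow> (\<chi> x \<noteq> \<chi> y \<longleftrightarrow> rosenstiehl V E x y = 1))"

definition framings_from_colouring :: "'a list \<Rightarrow> ('a \<Rightarrow> colour) \<Rightarrow> (nat \<Rightarrow> frame) set" where
  "framings_from_colouring w \<chi> = {\<phi> \<in> framings w. \<forall>i<length w.
     \<phi> i = \<phi> (Suc i mod length w) \<longleftrightarrow> \<chi> (w ! i) \<noteq> \<chi> (w ! (Suc i mod length w))}"

end

theory Submission
  imports Defs
begin

text \<open>
  Work modulo 2. By Euler's formula a framing has genus 0 if and only if every 1-cycle of its
  ribbon graph is a sum of boundaries of faces. The cycles are spanned by the whole curve and, for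
  each chord \<open>x\<close>, the arc from the first to the second occurrence of \<open>x\<close>. A cycle \<open>S\<close> bounds if and
  only if there is a face function whose jump across every band is \<open>S\<close>; integrating the jumps along
  the curve, this becomes one equation at each chord \<open>y\<close>. When degrees are even the whole curve always bounds.
  Let \<open>N x y\<close> be the number of positions inside the arc of \<open>x\<close> whose opposite lies inside the
  arc of \<open>y\<close>. For the arc of \<open>x\<close> the equation at \<open>y\<close> reads \<open>N x y = 0\<close> if \<open>x\<close> and \<open>y\<close> are not
  interlaced, and \<open>N x y = 1 + g x + g y\<close> otherwise, where \<open>g x\<close> tells whether the first
  occurrence of \<open>x\<close> is framed by infinity. Since \<open>N x y\<close> plus the number of positions inside both
  arcs is the number of common neighbours, the first case is (EN2), and the second one
  states that \<open>g x\<close> plus the position of the first occurrence of \<open>x\<close> integrates the Rosenstiehl form.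
  Two integrals differ by a locally constant function, hence the count.
\<close>

text \<open>As simp rules these turn sums into exclusive ors, out of reach of the ring lemmas.\<close>

declare add_bit_eq_xor [simp del] mult_bit_eq_and [simp del]

section \<open>Arithmetic in the field with two elements\<close>

lemma bit_add_self [simp]: "a + a = (0 :: bit)"
  by (cases a) auto

lemma bit_add_left_self [simp]: "a + (a + b) = (b :: bit)"
  by (cases a; cases b) auto

lemma bit_add_eq_0_iff: "a + b = 0 \<longleftrightarrow> a = (b :: bit)"
  by (cases a; cases b) auto

lemma UNIV_bit: "(UNIV :: bit set) = {0, 1}"
  by (auto intro: bit.exhaust)

lemma finite_UNIV_bit [simp]: "finite (UNIV :: bit set)"
  by (simp add: UNIV_bit)

lemma card_UNIV_bit [simp]: "card (UNIV :: bit set) = 2"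
  by (simp add: UNIV_bit)

lemma of_nat_bit: "(of_nat n :: bit) = of_bool (odd n)"
  by (induction n) auto

lemma of_nat_bit_eq_0_iff: "(of_nat n :: bit) = 0 \<longleftrightarrow> even n"
  by (simp add: of_nat_bit)

lemma sum_of_bool_bit: "finite A \<Longrightarrow> (\<Sum>a\<in>A. of_bool (P a) :: bit) = of_nat (card {a\<in>A. P a})"
  by (simp add: Collect_conj_eq Int_commute)

section \<open>Functions constant on the orbits of a permutation\<close>

lemma self_in_orbit_bij_betw:
  assumes "finite A" "bij_betw f A A" "a \<in> A"
  shows "a \<in> orbit f a"
proof -
  \<comment> \<open>The inductive \<open>orbit\<close> starts at \<open>f a\<close>, so membership
    of \<open>a\<close> has to be proved. Results on permutations require a map of the whole type,
    so \<open>f\<close> is extended by the identity; the orbit of \<open>a\<close> under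
    \<open>g\<close> stays inside \<open>orbit f a\<close>.\<close>
  define g where "g x = (if x \<in> A then f x else x)" for x
  have "bij_betw g A A"
    using assms(2) by (subst bij_betw_cong[where g = f]) (auto simp: g_def)
  then have "g permutes A"
    by (rule bij_imp_permutes) (simp add: g_def)
  then have "permutation g"
    using assms(1) permutation_permutes by blast
  then have self: "a \<in> orbit g a"
    by (rule permutation_self_in_orbit)
  have "x \<in> A \<and> x \<in> orbit f a" if "x \<in> orbit g a" for x
    using that
  proof induction
    case base
    then show ?case
      using assms bij_betwE[OF assms(2)] by (auto simp: g_def intro: orbit.intros)
  next
    case (step y)
    then show ?case
      using bij_betwE[OF assms(2)] by (auto simp: g_def intro: orbit.intros)
  qed
  with self show ?thesis
    by blast
qed

text \<open>An invariant function is constant on each orbit, hence the same thing as a function on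
  the set of orbits; the inverse correspondence evaluates it at a chosen representative. With the
  boundary walk for \<open>f\<close>, the number of boundary components becomes an exponent of
  2.\<close>

lemma card_invariant_functions:
  assumes fin: "finite A" and bij: "bij_betw f A A"
  shows "card {h \<in> A \<rightarrow>\<^sub>E (UNIV :: bit set). \<forall>a\<in>A. h (f a) = h a} = 2 ^ card (orbit f ` A)"
proof -
  let ?H = "{h \<in> A \<rightarrow>\<^sub>E (UNIV :: bit set). \<forall>a\<in>A. h (f a) = h a}"
  let ?O = "orbit f ` A"
  have self: "a \<in> orbit f a" if "a \<in> A" for a
    using self_in_orbit_bij_betw[OF fin bij that] .
  have fA: "f a \<in> A" if "a \<in> A" for a
    using bij that by (auto dest: bij_betwE)
  have orb: "b \<in> A \<and> orbit f b = orbit f a" if "b \<in> orbit f a" "a \<in> A" for a b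
    using that by induction (auto simp: fA self self_in_orbit_step)
  have const: "h b = h a" if "b \<in> orbit f a" "a \<in> A" "h \<in> ?H" for a b h
    using that(1)
  proof induction
    case (step y)
    with that orb[of y a] show ?case by auto
  qed (use that in auto)
  have "bij_betw (\<lambda>g. \<lambda>a\<in>A. g (orbit f a)) (?O \<rightarrow>\<^sub>E (UNIV :: bit set)) ?H"
  proof (rule bij_betw_byWitness[where f' = "\<lambda>h. \<lambda>b\<in>?O. h (SOME a. a \<in> b)"])
    show "\<forall>g\<in>?O \<rightarrow>\<^sub>E (UNIV :: bit set). (\<lambda>b\<in>?O. (\<lambda>a\<in>A. g (orbit f a)) (SOME a. a \<in> b)) = g"
    proof (intro ballI ext)
      fix g :: "'a set \<Rightarrow> bit" and b
      assume g: "g \<in> ?O \<rightarrow>\<^sub>E UNIV"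
      show "(\<lambda>b\<in>?O. (\<lambda>a\<in>A. g (orbit f a)) (SOME a. a \<in> b)) b = g b"
      proof (cases "b \<in> ?O")
        case True
        then obtain a where a: "a \<in> A" "b = orbit f a" by auto
        then have "(SOME a. a \<in> b) \<in> orbit f a"
          using self[OF a(1)] by (simp add: some_in_eq orbit_nonempty)
        with orb[OF this a(1)] a True show ?thesis by simp
      next
        case False
        then show ?thesis using g by (metis PiE_E restrict_apply)
      qed
    qed
    show "\<forall>h\<in>?H. (\<lambda>a\<in>A. (\<lambda>b\<in>?O. h (SOME a. a \<in> b)) (orbit f a)) = h"
    proof (intro ballI ext)
      fix h a assume h: "h \<in> ?H"
      show "(\<lambda>a\<in>A. (\<lambda>b\<in>?O. h (SOME a. a \<in> b)) (orbit f a)) a = h a"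
      proof (cases "a \<in> A")
        case True
        then have "(SOME x. x \<in> orbit f a) \<in> orbit f a"
          using self[OF True] by (simp add: some_in_eq orbit_nonempty)
        with const[OF this True h] True show ?thesis by simp
      next
        case False
        with h show ?thesis by (auto simp: PiE_def extensional_def)
      qed
    qed
  qed (auto simp: fA self self_in_orbit_step)
  then have "card ?H = card (?O \<rightarrow>\<^sub>E (UNIV :: bit set))"
    by (simp add: bij_betw_same_card)
  then show ?thesis
    using fin by (simp add: card_funcsetE)
qed

lemma card_fibres_eq:
  assumes "finite A" "\<And>b. b \<in> f ` A \<Longrightarrow> card {a \<in> A. f a = b} = k"
  shows "card A = k * card (f ` A)"
proof -
  have "card A = (\<Sum>b\<in>f ` A. card {a \<in> A. f a = b})"
    using assms(1) sum.image_gen[of A "\<lambda>_. 1::nat" f] by simp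
  with assms(2) show ?thesis by simp
qed

section \<open>Components and $H_0$\<close>

definition graph :: "'a set \<Rightarrow> 'a set set \<Rightarrow> bool" where
  "graph V E \<longleftrightarrow> finite V \<and> (\<forall>e\<in>E. \<exists>x\<in>V. \<exists>y\<in>V. x \<noteq> y \<and> e = {x, y})"

abbreviation connection :: "'a set \<Rightarrow> 'a set set \<Rightarrow> ('a \<times> 'a) set" where
  "connection V E \<equiv> {(x, y). x \<in> V \<and> y \<in> V \<and> (x, y) \<in> {(u, v). {u, v} \<in> E}\<^sup>*}"

lemma equiv_connection: "equiv V (connection V E)"
proof (rule equivI)
  have "sym {(u, v). {u, v} \<in> E}"
    by (auto simp: sym_def insert_commute)
  then have "sym ({(u, v). {u, v} \<in> E}\<^sup>*)"
    by (rule sym_rtrancl)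
  then show "sym (connection V E)"
    by (auto simp: sym_def)
  show "trans (connection V E)"
    by (auto simp: trans_def intro: rtrancl_trans)
qed (auto simp: refl_on_def)

lemma components_adjacent:
  assumes "K \<in> components V E" "{x, y} \<in> E" "x \<in> V" "y \<in> V"
  shows "x \<in> K \<longleftrightarrow> y \<in> K"
proof -
  have "(x, y) \<in> connection V E"
    using assms by auto
  moreover from this have "(y, x) \<in> connection V E"
    using equiv_connection[of V E] by (meson equivE symE)
  ultimately show ?thesis
    using assms(1) in_quotient_imp_closed[OF equiv_connection, of K V E]
    unfolding components_def by blast
qed

lemma Union_components: "\<Union> (components V E) = V"
  unfolding components_def by (rule Union_quotient[OF equiv_connection])

lemma disjoint_components:
  assumes "K \<in> components V E" "L \<in> components V E" "x \<in> K" "x \<in> L"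
  shows "K = L"
  using assms quotient_disj[OF equiv_connection] unfolding components_def by blast

lemma finite_components: "finite V \<Longrightarrow> finite (components V E)"
  using Union_components[of V E] by (metis finite_UnionD)

lemma components_nonempty: "K \<in> components V E \<Longrightarrow> K \<noteq> {}"
  unfolding components_def by (rule in_quotient_imp_non_empty[OF equiv_connection])

lemma Union_components_mem_iff:
  assumes "\<K> \<subseteq> components V E" "K \<in> components V E" "x \<in> K"
  shows "x \<in> \<Union>\<K> \<longleftrightarrow> K \<in> \<K>"
  using assms by (auto dest: disjoint_components)

lemma inj_on_Union_components: "inj_on Union (Pow (components V E))"
proof (rule inj_onI)
  fix \<K> \<L> assume KL: "\<K> \<in> Pow (components V E)" "\<L> \<in> Pow (components V E)" "\<Union>\<K> = \<Union>\<L>"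
  have "K \<in> \<K> \<longleftrightarrow> K \<in> \<L>" if K: "K \<in> components V E" for K
  proof -
    obtain x where "x \<in> K"
      using components_nonempty[OF K] by blast
    with KL K show ?thesis
      using Union_components_mem_iff[of \<K> V E K x] Union_components_mem_iff[of \<L> V E K x] by simp
  qed
  with KL show "\<K> = \<L>"
    by blast
qed

text \<open>A path cannot leave \<open>U\<close>, so \<open>U\<close> contains the component of each
  of its points. Paths are taken in \<open>E\<close> alone, and \<open>EV\<close> keeps their
  vertices in \<open>V\<close>.\<close>

lemma locally_constant_eq_Union_components:
  assumes "U \<subseteq> V" "\<And>x y. x \<in> V \<Longrightarrow> y \<in> V \<Longrightarrow> {x, y} \<in> E \<Longrightarrow> x \<in> U \<longleftrightarrow> y \<in> U"
    and EV: "\<And>e. e \<in> E \<Longrightarrow> e \<subseteq> V"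
  shows "U = \<Union>{K \<in> components V E. K \<subseteq> U}"
proof -
  have closed: "y \<in> U" if "(x, y) \<in> {(u, v). {u, v} \<in> E}\<^sup>*" "x \<in> U" for x y
    using that
  proof induction
    case (step y z)
    then show ?case using assms(2)[of y z] EV[of "{y, z}"] by auto
  qed
  have "\<exists>K\<in>components V E. x \<in> K \<and> K \<subseteq> U" if "x \<in> U" for x
  proof (intro bexI conjI)
    show "connection V E `` {x} \<in> components V E"
      using that assms(1) unfolding components_def by (intro quotientI) auto
    show "x \<in> connection V E `` {x}"
      using that assms(1) by auto
    show "connection V E `` {x} \<subseteq> U"
      using closed that by auto
  qed
  then show ?thesis by blast
qed

text \<open>Each edge has both ends in \<open>K\<close> or none, so after exchanging the sums it
  contributes \<open>s e\<close> twice or not at all.\<close>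

lemma sum_boundary_component:
  assumes G: "graph V E" and K: "K \<in> components V E"
  shows "(\<Sum>x\<in>K. boundary E s x) = 0"
proof -
  have finV: "finite V" and EP: "E \<subseteq> Pow V"
    using G unfolding graph_def by auto
  have finE: "finite E"
    using finV by (intro finite_subset[OF EP]) simp
  have KV: "K \<subseteq> V"
    using K Union_components[of V E] by blast
  then have finK: "finite K"
    using finV finite_subset by blast
  have "(\<Sum>x\<in>K. boundary E s x) = (\<Sum>x\<in>K. \<Sum>e\<in>E. if x \<in> e then s e else 0)"
    using finE by (intro sum.cong) (simp_all add: boundary_def sum.inter_filter)
  also have "\<dots> = (\<Sum>e\<in>E. \<Sum>x\<in>K. if x \<in> e then s e else 0)"
    by (rule sum.swap)
  also have "\<dots> = 0"
  proof (rule sum.neutral, rule ballI)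
    fix e assume "e \<in> E"
    then obtain x y where e: "x \<in> V" "y \<in> V" "x \<noteq> y" "e = {x, y}"
      using G unfolding graph_def by blast
    have "(\<Sum>x\<in>K. if x \<in> e then s e else 0) = (\<Sum>x\<in>K \<inter> e. s e)"
      by (rule sum.inter_restrict[OF finK, symmetric])
    also have "\<dots> = 0"
    proof (cases "x \<in> K")
      case True
      then have "K \<inter> e = {x, y}"
        using components_adjacent[OF K] e \<open>e \<in> E\<close> by blast
      then show ?thesis using e by simp
    next
      case False
      then have "K \<inter> e = {}"
        using components_adjacent[OF K] e \<open>e \<in> E\<close> by blast
      then show ?thesis by simp
    qed
    finally show "(\<Sum>x\<in>K. if x \<in> e then s e else 0) = 0" .
  qed
  finally show ?thesis .
qed

section \<open>Boundaries of 1-chains\<close>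

definition boundaries :: "'a set set \<Rightarrow> ('a \<Rightarrow> bit) set" where
  "boundaries E = {b. \<exists>s\<in>chains E. \<forall>x. b x = boundary E s x}"

lemma boundaries_add: "b \<in> boundaries E \<Longrightarrow> c \<in> boundaries E \<Longrightarrow> (\<lambda>x. b x + c x) \<in> boundaries E"
proof -
  assume "b \<in> boundaries E" "c \<in> boundaries E"
  then obtain s t where "s \<in> chains E" "t \<in> chains E" "\<forall>x. b x = boundary E s x" "\<forall>x. c x = boundary E t x"
    by (auto simp: boundaries_def)
  then have "(\<lambda>e. s e + t e) \<in> chains E \<and> (\<forall>x. b x + c x = boundary E (\<lambda>e. s e + t e) x)"
    by (auto simp: chains_def boundary_def sum.distrib)
  then show ?thesis unfolding boundaries_def by blast
qed

lemma boundaries_0: "(\<lambda>x. 0) \<in> boundaries E"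
  unfolding boundaries_def by (auto simp: chains_def boundary_def intro!: bexI[where x = "\<lambda>_. 0"])

lemma boundaries_sum:
  "finite A \<Longrightarrow> (\<And>a. a \<in> A \<Longrightarrow> b a \<in> boundaries E) \<Longrightarrow> (\<lambda>x. \<Sum>a\<in>A. b a x) \<in> boundaries E"
  by (induction A rule: finite_induct) (auto simp: boundaries_0 intro: boundaries_add)

lemma edge_in_boundaries:
  assumes "finite E" "{x, y} \<in> E" "x \<noteq> y"
  shows "(\<lambda>z. of_bool (z = x) + of_bool (z = y)) \<in> boundaries E"
proof -
  define s :: "'a set \<Rightarrow> bit" where "s e = of_bool (e = {x, y})" for e
  have "boundary E s z = of_bool (z = x) + of_bool (z = y)" for z
  proof -
    have "boundary E s z = (\<Sum>e\<in>{e\<in>E. z \<in> e} \<inter> {{x, y}}. 1)"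
      unfolding boundary_def s_def using assms(1)
      by (subst sum.inter_restrict) (auto intro: sum.cong)
    also have "{e\<in>E. z \<in> e} \<inter> {{x, y}} = (if z = x \<or> z = y then {{x, y}} else {})"
      using assms(2) by auto
    finally show ?thesis using assms(3) by auto
  qed
  moreover have "s \<in> chains E"
    using assms(2) by (auto simp: chains_def s_def)
  ultimately show ?thesis
    unfolding boundaries_def by (intro CollectI bexI[of _ s]) simp_all
qed

text \<open>The edges of a path telescope: modulo 2 every intermediate vertex cancels.\<close>

lemma connected_in_boundaries:
  assumes G: "graph V E" and "(x, y) \<in> {(u, v). {u, v} \<in> E}\<^sup>*"
  shows "(\<lambda>z. of_bool (z = x) + of_bool (z = y)) \<in> boundaries E"
  using assms(2)
proof induction
  case base
  then show ?case by (simp add: boundaries_0)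
next
  case (step y z)
  have "finite E"
  proof (rule finite_subset)
    show "E \<subseteq> Pow V" using G by (auto simp: graph_def)
    show "finite (Pow V)" using G by (auto simp: graph_def)
  qed
  moreover have "y \<noteq> z"
  proof -
    obtain u v where "u \<noteq> v" "{y, z} = {u, v}"
      using step G unfolding graph_def by blast
    then show ?thesis by force
  qed
  ultimately have "(\<lambda>u. of_bool (u = y) + of_bool (u = z)) \<in> boundaries E"
    using step by (auto intro: edge_in_boundaries)
  from boundaries_add[OF step.IH this] show ?case
    by (simp add: add.assoc)
qed

text \<open>One direction is \<open>sum_boundary_component\<close>. For the other, each vertex of
  the support is joined by a path to the representative of its component; if the component sums
  vanish, every representative is hit an even number of times.\<close>

lemma boundaries_iff:
  assumes G: "graph V E" and c: "c \<in> chains V"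
  shows "c \<in> boundaries E \<longleftrightarrow> (\<forall>K\<in>components V E. (\<Sum>x\<in>K. c x) = 0)"
proof
  assume "c \<in> boundaries E"
  then show "\<forall>K\<in>components V E. (\<Sum>x\<in>K. c x) = 0"
    using sum_boundary_component[OF G] by (auto simp: boundaries_def)
next
  assume zero: "\<forall>K\<in>components V E. (\<Sum>x\<in>K. c x) = 0"
  have finV: "finite V" using G by (simp add: graph_def)
  have "\<forall>x\<in>V. \<exists>K\<in>components V E. x \<in> K"
    using Union_components[of V E] by blast
  then obtain comp where comp: "\<And>x. x \<in> V \<Longrightarrow> comp x \<in> components V E \<and> x \<in> comp x"
    by metis
  define r where "r x = (SOME y. y \<in> comp x)" for x
  have r: "r x \<in> comp x" if "x \<in> V" for x
    unfolding r_def using comp[OF that] by (auto intro: someI)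
  have rel: "(x, r x) \<in> {(u, v). {u, v} \<in> E}\<^sup>*" if "x \<in> V" for x
  proof -
    have "(x, r x) \<in> connection V E"
      using comp[OF that] r[OF that] quotient_eq_iff[OF equiv_connection, of "comp x" V E "comp x" x "r x"]
      unfolding components_def by blast
    then show ?thesis by simp
  qed
  have "(\<lambda>z. \<Sum>x\<in>{x\<in>V. c x = 1}. of_bool (z = x) + of_bool (z = r x)) \<in> boundaries E"
    using finV rel connected_in_boundaries[OF G] by (intro boundaries_sum) auto
  moreover have "(\<Sum>x\<in>{x\<in>V. c x = 1}. of_bool (z = x) + of_bool (z = r x)) = c z" for z
  proof -
    \<comment> \<open>Grouped by component, the representative of \<open>K\<close> receives the sum
      of \<open>c\<close> over \<open>K\<close>, which is 0.\<close>
    have "(\<Sum>x\<in>{x\<in>V. c x = 1}. of_bool (z = r x) :: bit) = 0"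
    proof -
      have "(\<Sum>x\<in>{x\<in>V. c x = 1}. of_bool (z = r x) :: bit) = (\<Sum>x\<in>V. c x * of_bool (z = r x))"
        using finV by (intro sum.mono_neutral_cong_left) auto
      also have "\<dots> = (\<Sum>K\<in>comp ` V. \<Sum>x\<in>{x\<in>V. comp x = K}. c x * of_bool (z = r x))"
        using finV by (rule sum.image_gen)
      also have "\<dots> = 0"
      proof (rule sum.neutral, rule ballI)
        fix K assume "K \<in> comp ` V"
        then have K: "K \<in> components V E" using comp by auto
        have eq: "{x\<in>V. comp x = K} = K"
          using K comp Union_components[of V E] by (auto dest: disjoint_components)
        have "(\<Sum>x\<in>{x\<in>V. comp x = K}. c x * of_bool (z = r x))
            = (\<Sum>x\<in>{x\<in>V. comp x = K}. c x * of_bool (z = (SOME y. y \<in> K)))"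
          by (intro sum.cong) (auto simp: r_def)
        also have "\<dots> = (\<Sum>x\<in>K. c x) * of_bool (z = (SOME y. y \<in> K))"
          by (simp only: eq sum_distrib_right)
        finally show "(\<Sum>x\<in>{x\<in>V. comp x = K}. c x * of_bool (z = r x)) = 0"
          using zero K by simp
      qed
      finally show ?thesis .
    qed
    moreover have "(\<Sum>x\<in>{x\<in>V. c x = 1}. of_bool (z = x) :: bit) = c z"
    proof -
      have "(\<Sum>x\<in>{x\<in>V. c x = 1}. of_bool (z = x) :: bit) = (\<Sum>x\<in>{x\<in>V. c x = 1}. if z = x then 1 else 0)"
        by (intro sum.cong) auto
      then show ?thesis
        using c finV by (auto simp: chains_def)
    qed
    ultimately show ?thesis by (simp add: sum.distrib)
  qed
  ultimately show "c \<in> boundaries E" by simp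
qed

text \<open>By \<open>boundaries_iff\<close> the sums over the components are a complete invariant
  of a class, and they take arbitrary values, so classes correspond to functions on the set of
  components.\<close>

lemma card_H0:
  assumes G: "graph V E"
  shows "card (H0 V E) = 2 ^ card (components V E)"
proof -
  have finV: "finite V" using G by (simp add: graph_def)
  define R where "R = {(c, d). c \<in> chains V \<and> d \<in> chains V \<and>
        (\<exists>s\<in>chains E. \<forall>x. d x - c x = boundary E s x)}"
  define f where "f c = (\<lambda>K\<in>components V E. \<Sum>x\<in>K. c x)" for c :: "'a \<Rightarrow> bit"
  have R: "(c, d) \<in> R \<longleftrightarrow> f c = f d" if "c \<in> chains V" "d \<in> chains V" for c d
  proof -
    have "(c, d) \<in> R \<longleftrightarrow> (\<lambda>x. d x + c x) \<in> boundaries E"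
      using that by (simp add: R_def boundaries_def)
    also have "\<dots> \<longleftrightarrow> (\<forall>K\<in>components V E. (\<Sum>x\<in>K. d x + c x) = 0)"
      using that by (intro boundaries_iff[OF G]) (auto simp: chains_def)
    also have "\<dots> \<longleftrightarrow> f c = f d"
      by (auto simp: f_def sum.distrib bit_add_eq_0_iff restrict_def fun_eq_iff)
    finally show ?thesis .
  qed
  have RV: "R \<subseteq> chains V \<times> chains V" by (auto simp: R_def)
  have H0: "H0 V E = (\<lambda>c. R `` {c}) ` chains V"
    unfolding H0_def R_def[symmetric] quotient_def by auto
  have "bij_betw (\<lambda>b. {c \<in> chains V. f c = b}) (f ` chains V) (H0 V E)"
  proof (rule bij_betw_imageI)
    show "inj_on (\<lambda>b. {c \<in> chains V. f c = b}) (f ` chains V)"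
      by (rule inj_onI) blast
    have "{d \<in> chains V. f d = f c} = R `` {c}" if "c \<in> chains V" for c
      using R[OF that] RV by auto
    then show "(\<lambda>b. {c \<in> chains V. f c = b}) ` f ` chains V = H0 V E"
      unfolding H0 image_image by (rule image_cong[OF refl])
  qed
  moreover have "f ` chains V = components V E \<rightarrow>\<^sub>E UNIV"
  proof (intro equalityI subsetI)
    fix b :: "'a set \<Rightarrow> bit"
    assume b: "b \<in> components V E \<rightarrow>\<^sub>E UNIV"
    \<comment> \<open>The preimage of \<open>b\<close> has the value \<open>b K\<close> at the
      chosen representative of \<open>K\<close> and 0 at all other vertices.\<close>
    define c where "c x = (if \<exists>K\<in>components V E. x = (SOME y. y \<in> K)
      then b (THE K. K \<in> components V E \<and> x \<in> K) else 0)" for x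
    have some: "(SOME y. y \<in> K) \<in> K" if "K \<in> components V E" for K
      using components_nonempty[OF that] by (metis ex_in_conv someI)
    have c: "c x = b K * of_bool (x = (SOME y. y \<in> K))" if "K \<in> components V E" "x \<in> K" for K x
    proof -
      have "(THE K. K \<in> components V E \<and> x \<in> K) = K"
        using that by (intro the_equality) (auto dest: disjoint_components)
      moreover have "(\<exists>L\<in>components V E. x = (SOME y. y \<in> L)) \<longleftrightarrow> x = (SOME y. y \<in> K)"
      proof
        assume "\<exists>L\<in>components V E. x = (SOME y. y \<in> L)"
        then obtain L where L: "L \<in> components V E" "x = (SOME y. y \<in> L)" by blast
        with some have "x \<in> L" by simp
        with L that have "L = K" by (auto dest: disjoint_components)
        with L show "x = (SOME y. y \<in> K)" by simp
      qed (use that in blast)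
      ultimately show ?thesis by (simp only: c_def) simp
    qed
    have "c \<in> chains V"
      using some Union_components[of V E] unfolding chains_def c_def by (auto split: if_splits)
    moreover have "f c = b"
    proof
      fix K
      show "f c K = b K"
      proof (cases "K \<in> components V E")
        case True
        have "finite K" using True finV Union_components[of V E] by (metis Sup_upper finite_subset)
        have "(\<Sum>x\<in>K. c x) = (\<Sum>x\<in>K. if x = (SOME y. y \<in> K) then b K else 0)"
          using True by (intro sum.cong) (auto simp: c)
        also have "\<dots> = b K"
          using \<open>finite K\<close> some[OF True] by simp
        finally show ?thesis using True by (simp add: f_def)
      next
        case False
        with b show ?thesis by (auto simp: f_def PiE_def extensional_def)
      qed
    qed
    ultimately show "b \<in> f ` chains V" by blast
  qed (auto simp: f_def)
  ultimately have "card (H0 V E) = card (components V E \<rightarrow>\<^sub>E (UNIV :: bit set))"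
    by (simp add: bij_betw_same_card)
  then show ?thesis
    using finite_components[OF finV] by (simp add: card_funcsetE)
qed

section \<open>Chord words and their interlace graphs\<close>

lemma interlaced_sym: "interlaced w x y \<longleftrightarrow> interlaced w y x"
  unfolding interlaced_def by (subst (2) disj_commute) (simp only: eq_commute[of x y])

lemma interlaced_imp_mem: "interlaced w x y \<Longrightarrow> x \<in> set w \<and> y \<in> set w"
  unfolding interlaced_def by (auto intro: nth_mem)

lemma interlace_edges_iff: "{x, y} \<in> interlace_edges w \<longleftrightarrow> interlaced w x y"
  unfolding interlace_edges_def by (auto simp: doubleton_eq_iff interlaced_sym[of w y x])

lemma graph_interlace: "graph (set w) (interlace_edges w)"
  unfolding graph_def interlace_edges_def
proof (intro conjI ballI)
  fix e assume "e \<in> {{x, y} |x y. interlaced w x y}"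
  then obtain x y where "interlaced w x y" "e = {x, y}" by blast
  moreover from this have "x \<in> set w" "y \<in> set w" "x \<noteq> y"
    using interlaced_imp_mem[of w x y] by (simp_all add: interlaced_def)
  ultimately show "\<exists>x\<in>set w. \<exists>y\<in>set w. x \<noteq> y \<and> e = {x, y}"
    by blast
qed simp

lemma adjacency_sym: "adjacency E x y = adjacency E y x"
  by (simp add: adjacency_def insert_commute)

locale chord_word =
  fixes w :: "'a list"
  assumes chord_diagram: "chord_diagram w"
begin

abbreviation "m \<equiv> length w"
abbreviation "V \<equiv> set w"
abbreviation "opp \<equiv> other_occurrence w"

definition first :: "'a \<Rightarrow> nat" where
  "first x = (SOME i. i < m \<and> w ! i = x \<and> i < opp i)"

definition second :: "'a \<Rightarrow> nat" where
  "second x = opp (first x)"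

lemma card_occurrences:
  assumes "x \<in> V"
  shows "card {i. i < m \<and> w ! i = x} = 2"
proof -
  have "{i. i < m \<and> w ! i = x} = {i. i < m \<and> x = w ! i}" by auto
  then show ?thesis
    using chord_diagram length_filter_conv_card[of "(=) x" w] assms
    by (simp add: chord_diagram_def count_list_eq_length_filter)
qed

lemma opp_unique_ex:
  assumes "i < m"
  shows "\<exists>!j. j < m \<and> j \<noteq> i \<and> w ! j = w ! i"
proof -
  have "card {j. j < m \<and> w ! j = w ! i} = 2"
    using assms by (intro card_occurrences) auto
  then obtain a b where ab: "a \<noteq> b" "{j. j < m \<and> w ! j = w ! i} = {a, b}"
    by (auto simp: card_2_iff)
  then have *: "j < m \<and> w ! j = w ! i \<longleftrightarrow> j = a \<or> j = b" for j
    by blast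
  then consider "i = a" | "i = b" using assms by blast
  then show ?thesis
  proof cases
    case 1
    with ab(1) * show ?thesis by (intro ex1I[of _ b]) auto
  next
    case 2
    with ab(1) * show ?thesis by (intro ex1I[of _ a]) auto
  qed
qed

lemma
  assumes "i < m"
  shows opp_less [simp]: "opp i < m" and opp_neq [simp]: "opp i \<noteq> i" and nth_opp [simp]: "w ! opp i = w ! i"
proof -
  have "opp i < m \<and> opp i \<noteq> i \<and> w ! opp i = w ! i"
    unfolding other_occurrence_def by (rule theI'[OF opp_unique_ex[OF assms]])
  then show "opp i < m" "opp i \<noteq> i" "w ! opp i = w ! i"
    by blast+
qed

lemma same_letter:
  assumes "i < m" "j < m" "w ! j = w ! i"
  shows "j = i \<or> j = opp i"
proof (cases "j = i")
  case False
  with assms have "opp i = j"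
    unfolding other_occurrence_def by (intro the1_equality[OF opp_unique_ex]) simp_all
  then show ?thesis by simp
qed simp

lemma opp_opp [simp]:
  assumes "i < m"
  shows "opp (opp i) = i"
proof -
  have "i = opp i \<or> i = opp (opp i)"
    using assms by (intro same_letter) simp_all
  with opp_neq[OF assms] show ?thesis by metis
qed

lemma first_props:
  assumes "x \<in> V"
  shows "first x < m \<and> w ! first x = x \<and> first x < opp (first x)"
proof -
  obtain i where i: "i < m" "w ! i = x"
    using assms by (auto simp: in_set_conv_nth)
  have "\<exists>i. i < m \<and> w ! i = x \<and> i < opp i"
  proof (cases "i < opp i")
    case False
    then have "opp i < i"
      using opp_neq[OF i(1)] by linarith
    with i show ?thesis
      by (intro exI[of _ "opp i"]) simp
  next
    case True
    with i show ?thesis by auto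
  qed
  then show ?thesis
    unfolding first_def by (rule someI_ex[where P = "\<lambda>i. i < m \<and> w ! i = x \<and> i < opp i"])
qed

lemma
  assumes "x \<in> V"
  shows first_less_second [simp]: "first x < second x"
    and second_less [simp]: "second x < m"
    and first_less [simp]: "first x < m"
    and nth_first [simp]: "w ! first x = x"
    and nth_second [simp]: "w ! second x = x"
    and opp_first [simp]: "opp (first x) = second x"
    and opp_second [simp]: "opp (second x) = first x"
  using first_props[OF assms] opp_less[of "first x"] nth_opp[of "first x"] opp_opp[of "first x"]
  unfolding second_def by simp_all

lemma position_cases:
  assumes "i < m"
  shows "i = first (w ! i) \<or> i = second (w ! i)"
proof -
  have V: "w ! i \<in> V" using assms by (rule nth_mem)
  have "i = first (w ! i) \<or> i = opp (first (w ! i))"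
    using nth_first[OF V] by (intro same_letter[OF first_less[OF V] assms]) (rule sym)
  then show ?thesis unfolding opp_first[OF V] .
qed

lemma first_eq_iff: "x \<in> V \<Longrightarrow> y \<in> V \<Longrightarrow> first x = first y \<longleftrightarrow> x = y"
  by (metis nth_first)

lemma second_eq_iff: "x \<in> V \<Longrightarrow> y \<in> V \<Longrightarrow> second x = second y \<longleftrightarrow> x = y"
  by (metis nth_second)

lemma first_neq_second: "x \<in> V \<Longrightarrow> y \<in> V \<Longrightarrow> first x \<noteq> second y"
proof
  assume "x \<in> V" "y \<in> V" and eq: "first x = second y"
  then have "x = y"
    by (metis nth_first nth_second)
  with eq first_less_second[OF \<open>x \<in> V\<close>] show False by simp
qed

lemma sum_positions: "(\<Sum>i<m. g i) = (\<Sum>x\<in>V. g (first x) + g (second x))"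
proof -
  have "(\<Sum>i<m. g i) = (\<Sum>x\<in>(!) w ` {..<m}. \<Sum>i\<in>{i \<in> {..<m}. w ! i = x}. g i)"
    by (rule sum.image_gen) simp
  also have "(!) w ` {..<m} = V"
    using nth_image[of m w] by (simp add: lessThan_atLeast0)
  also have "(\<Sum>x\<in>V. \<Sum>i\<in>{i \<in> {..<m}. w ! i = x}. g i) = (\<Sum>x\<in>V. g (first x) + g (second x))"
  proof (rule sum.cong[OF refl])
    fix x assume x: "x \<in> V"
    then have "{i \<in> {..<m}. w ! i = x} = {first x, second x}"
      using position_cases by auto
    then show "(\<Sum>i\<in>{i \<in> {..<m}. w ! i = x}. g i) = g (first x) + g (second x)"
      using first_less_second[OF x] by simp
  qed
  finally show ?thesis .
qed

lemma sum_opp: "(\<Sum>i<m. g (opp i)) = (\<Sum>i<m. g i :: 'b :: comm_monoid_add)"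
  by (simp add: sum_positions add.commute)

lemma even_length: "even m"
proof -
  have "m = (\<Sum>i<m. 1 :: nat)" by simp
  also have "\<dots> = 2 * card V" by (subst sum_positions) simp
  finally show ?thesis by simp
qed

section \<open>Interiors of the arcs\<close>

definition inside :: "'a \<Rightarrow> nat \<Rightarrow> bit" where
  "inside x i = of_bool (first x < i \<and> i < second x)"

lemma inside_self [simp]: "x \<in> V \<Longrightarrow> inside x (first x) = 0" "x \<in> V \<Longrightarrow> inside x (second x) = 0"
  by (auto simp: inside_def)

lemma interlaced_iff:
  assumes "x \<in> V" "y \<in> V"
  shows "interlaced w x y \<longleftrightarrow> first x < first y \<and> first y < second x \<and> second x < second y \<or>
    first y < first x \<and> first x < second y \<and> second y < second x"
    (is "_ \<longleftrightarrow> ?R x y \<or> ?R y x")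
proof
  \<comment> \<open>Each letter has only two occurrences, so an alternating pattern determines all
    four positions.\<close>
  have *: "?R x y" if "i < j" "j < k" "k < l" "l < m" "w ! i = x" "w ! j = y" "w ! k = x" "w ! l = y"
    for i j k l x y
  proof -
    have "x \<in> V" "y \<in> V" using that by (auto intro: nth_mem)
    moreover have "i < m" "j < m" "k < m" using that by auto
    ultimately have "i = first x" "k = second x" "j = first y" "l = second y"
      using that position_cases[of i] position_cases[of j] position_cases[of k] position_cases[of l]
        first_less_second[of x] first_less_second[of y]
      by (auto simp del: first_less_second)
    with that show ?thesis by simp
  qed
  assume "interlaced w x y"
  then show "?R x y \<or> ?R y x"
    unfolding interlaced_def using * by blast
next
  assume R: "?R x y \<or> ?R y x"
  then have "x \<noteq> y" by auto
  from R show "interlaced w x y"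
  proof
    assume "?R x y"
    with assms \<open>x \<noteq> y\<close> show ?thesis unfolding interlaced_def
      by (intro conjI exI[of _ "first x"] exI[of _ "first y"] exI[of _ "second x"] exI[of _ "second y"]) auto
  next
    assume "?R y x"
    with assms \<open>x \<noteq> y\<close> show ?thesis unfolding interlaced_def
      by (intro conjI exI[of _ "first x"] exI[of _ "first y"] exI[of _ "second x"] exI[of _ "second y"]) auto
  qed
qed

abbreviation "E \<equiv> interlace_edges w"

lemma adjacency_eq_of_bool: "adjacency E x y = of_bool (interlaced w x y)"
  by (simp add: adjacency_def interlace_edges_iff)

text \<open>The sum is 1 exactly when one occurrence of \<open>y\<close> is inside the arc of
  \<open>x\<close> and the other is not, which is alternation. For \<open>x = y\<close> both terms
  are 0.\<close>

lemma adjacency_eq: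
  assumes "x \<in> V" "y \<in> V"
  shows "adjacency E x y = inside x (first y) + inside x (second y)"
proof (cases "x = y")
  case True
  with assms show ?thesis
    by (simp add: adjacency_eq_of_bool interlaced_def)
next
  case False
  then show ?thesis
    using first_eq_iff[OF assms] second_eq_iff[OF assms] first_neq_second[OF assms] first_neq_second[OF assms(2,1)]
      first_less_second[OF assms(1)] first_less_second[OF assms(2)]
    unfolding adjacency_eq_of_bool interlaced_iff[OF assms] inside_def
    by (auto simp del: first_less_second)
qed

text \<open>When the product is multiplied out, the terms at the same occurrence count the positions
  inside both arcs, and the mixed terms count the positions inside the arc of \<open>x\<close> whose
  opposite lies inside the arc of \<open>y\<close>.\<close>

lemma common_neighbours:
  assumes "x \<in> V" "y \<in> V"
  shows "(\<Sum>z\<in>V. adjacency E x z * adjacency E z y)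
    = (\<Sum>i<m. inside x i * inside y i) + (\<Sum>i<m. inside x i * inside y (opp i))"
proof -
  have "(\<Sum>z\<in>V. adjacency E x z * adjacency E z y)
      = (\<Sum>z\<in>V. (inside x (first z) + inside x (second z)) * (inside y (first z) + inside y (second z)))"
    using assms adjacency_eq[OF assms(1)] adjacency_eq[OF assms(2)] adjacency_sym[of E _ y]
    by (intro sum.cong) auto
  also have "\<dots> = (\<Sum>i<m. inside x i * (inside y i + inside y (opp i)))"
    unfolding sum_positions by (intro sum.cong) (auto simp: algebra_simps)
  finally show ?thesis
    by (simp add: distrib_left sum.distrib)
qed

end

text \<open>These are the parity conditions (EN1) and (EN2) as sums modulo 2; the coboundary
  condition enters later, through a colouring. \<open>even_common\<close> ranges over all
  non-interlaced pairs, the diagonal included.\<close>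

locale even_chord_word = chord_word +
  assumes even_degree: "\<And>x. x \<in> V \<Longrightarrow> (\<Sum>y\<in>V. adjacency E x y) = 0"
    and even_common: "\<And>x y. x \<in> V \<Longrightarrow> y \<in> V \<Longrightarrow> adjacency E x y = 0 \<Longrightarrow> (\<Sum>z\<in>V. adjacency E x z * adjacency E z y) = 0"
begin

text \<open>A letter with both or no occurrences inside the arc contributes 0, so the sum is the
  degree of \<open>x\<close> modulo 2.\<close>

lemma sum_inside:
  assumes "x \<in> V"
  shows "(\<Sum>i<m. inside x i) = 0"
proof -
  have "(\<Sum>i<m. inside x i) = (\<Sum>y\<in>V. adjacency E x y)"
    unfolding sum_positions using adjacency_eq[OF assms] by (intro sum.cong) auto
  with even_degree[OF assms] show ?thesis by simp
qed

lemma sum_of_bool_interval: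
  "b \<le> m \<Longrightarrow> (\<Sum>i<m. of_bool (a < i \<and> i < b) :: bit) = of_nat (b - Suc a)"
proof -
  assume "b \<le> m"
  then have "{i \<in> {..<m}. a < i \<and> i < b} = {Suc a..<b}" by auto
  then show ?thesis
    unfolding sum_of_bool_bit[OF finite_lessThan] by simp
qed

text \<open>By even degree the two occurrences of \<open>x\<close> enclose an even number of
  positions, so they have opposite parities. This is Gauss's classical condition.\<close>

lemma parity_second:
  assumes "x \<in> V"
  shows "of_nat (second x) = (of_nat (first x) + 1 :: bit)"
proof -
  have "of_nat (second x - Suc (first x)) = (0 :: bit)"
    using sum_inside[OF assms] sum_of_bool_interval[of "second x" "first x"] second_less[OF assms]
    by (simp add: inside_def)
  moreover have "second x = second x - Suc (first x) + Suc (first x)"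
    using first_less_second[OF assms] by linarith
  ultimately show ?thesis
    by (metis add.commute add_0 of_nat_Suc of_nat_add)
qed

text \<open>Interlaced arcs overlap in one interval, from the first occurrence of one chord to the
  second of the other; \<open>parity_second\<close> expresses its parity through first occurrences.
  Otherwise the interiors are disjoint or nested, and a nested intersection is a whole interior,
  even by \<open>sum_inside\<close>.\<close>

lemma sum_inside_inside:
  assumes "x \<in> V" "y \<in> V"
  shows "(\<Sum>i<m. inside x i * inside y i) = adjacency E x y * (of_nat (first x) + of_nat (first y))"
proof -
  have overlap: "(\<Sum>i<m. inside x i * inside y i) = of_nat (first x) + of_nat (first y)"
    if x: "x \<in> V" and y: "y \<in> V" and "first x < first y" "first y < second x" "second x < second y" for x y
  proof -
    have "(\<Sum>i<m. inside x i * inside y i) = (\<Sum>i<m. of_bool (first y < i \<and> i < second x))"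
      using that by (intro sum.cong) (auto simp: inside_def)
    also have "\<dots> = of_nat (second x - Suc (first y))"
      using second_less[OF x] by (intro sum_of_bool_interval) simp
    \<comment> \<open>Adding \<open>Suc (first y)\<close> twice changes nothing modulo 2 and removes
      the truncated subtraction.\<close>
    also have "\<dots> = of_nat (second x - Suc (first y) + Suc (first y)) + of_nat (Suc (first y))"
      by (simp add: add.assoc add.commute add.left_commute)
    also have "second x - Suc (first y) + Suc (first y) = second x"
      using that by linarith
    finally show ?thesis
      by (simp add: parity_second[OF x] algebra_simps)
  qed
  \<comment> \<open>The inequalities are weak so that \<open>x = y\<close> falls under this
    case.\<close>
  have nested: "(\<Sum>i<m. inside x i * inside y i) = 0"
    if x: "x \<in> V" and y: "y \<in> V" and "first y \<le> first x" "second x \<le> second y" for x y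
  proof -
    have "(\<Sum>i<m. inside x i * inside y i) = (\<Sum>i<m. inside x i)"
      using that by (intro sum.cong) (auto simp: inside_def)
    then show ?thesis using sum_inside[OF x] by simp
  qed
  show ?thesis
  proof (cases "interlaced w x y")
    case True
    then show ?thesis
      using overlap[OF assms] overlap[OF assms(2,1)] unfolding interlaced_iff[OF assms]
      by (auto simp: adjacency_eq_of_bool True mult.commute[of "inside y _"] add.commute)
  next
    case False
    consider "second x \<le> first y" | "second y \<le> first x"
      | "first y \<le> first x" "second x \<le> second y" | "first x \<le> first y" "second y \<le> second x"
      using False first_eq_iff[OF assms] second_eq_iff[OF assms] unfolding interlaced_iff[OF assms]
      by linarith
    then have "(\<Sum>i<m. inside x i * inside y i) = 0"
    proof cases
      case 1
      then show ?thesis by (intro sum.neutral) (auto simp: inside_def)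
    next
      case 2
      then show ?thesis by (intro sum.neutral) (auto simp: inside_def)
    next
      case 3
      then show ?thesis by (rule nested[OF assms])
    next
      case 4
      then show ?thesis using nested[OF assms(2,1)] by (simp add: mult.commute)
    qed
    with False show ?thesis by (simp add: adjacency_eq_of_bool)
  qed
qed

text \<open>In \<open>common_neighbours\<close>, the positions inside both arcs reduce to the
  parities of the first occurrences by \<open>sum_inside_inside\<close>; the remaining sum is the
  one that occurs in the bounding equations of the arcs.\<close>

lemma rosenstiehl_eq:
  assumes "x \<in> V" "y \<in> V" "interlaced w x y"
  shows "rosenstiehl V E x y = 1 + of_nat (first x) + of_nat (first y) + (\<Sum>i<m. inside x i * inside y (opp i))"
  using assms(3) unfolding rosenstiehl_def common_neighbours[OF assms(1,2)] sum_inside_inside[OF assms(1,2)]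
  by (simp add: adjacency_eq_of_bool add.assoc)

lemma sum_inside_opp_eq_0:
  assumes "x \<in> V" "y \<in> V" "\<not> interlaced w x y"
  shows "(\<Sum>i<m. inside x i * inside y (opp i)) = 0"
proof -
  have "adjacency E x y = 0"
    using assms(3) by (simp add: adjacency_eq_of_bool)
  with common_neighbours[OF assms(1,2)] sum_inside_inside[OF assms(1,2)] even_common[OF assms(1,2)]
  show ?thesis by simp
qed

end

lemma even_chord_wordI:
  assumes "chord_diagram w" "gaussian (set w) (interlace_edges w)"
  shows "even_chord_word w"
proof -
  interpret chord_word w by unfold_locales fact
  show ?thesis
  proof unfold_locales
    fix x assume x: "x \<in> V"
    have "(\<Sum>y\<in>V. adjacency E x y) = of_nat (card {y \<in> V. {x, y} \<in> E})"
      unfolding adjacency_eq_of_bool interlace_edges_iff by (rule sum_of_bool_bit) simp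
    also have "\<dots> = 0"
      using assms(2) x by (simp add: gaussian_def of_nat_bit_eq_0_iff)
    finally show "(\<Sum>y\<in>V. adjacency E x y) = 0" .
    have "x = y \<or> even (card {z \<in> V. {x, z} \<in> E \<and> {y, z} \<in> E})"
      if "y \<in> V" "adjacency E x y = 0" for y
      using assms(2) x that by (auto simp: gaussian_def adjacency_def split: if_splits)
    moreover have common: "(\<Sum>z\<in>V. adjacency E x z * adjacency E z y)
        = of_nat (card {z \<in> V. {x, z} \<in> E \<and> {y, z} \<in> E})" for y
    proof -
      have "(\<Sum>z\<in>V. adjacency E x z * adjacency E z y)
          = (\<Sum>z\<in>V. of_bool (interlaced w x z \<and> interlaced w y z))"
        by (intro sum.cong) (auto simp: adjacency_eq_of_bool interlaced_sym[of w y])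
      then show ?thesis
        unfolding interlace_edges_iff by (simp only: sum_of_bool_bit finite_set)
    qed
    \<comment> \<open>The common neighbours of \<open>x\<close> with itself are its neighbours, so
      even degree settles the diagonal case.\<close>
    moreover have "(\<Sum>z\<in>V. adjacency E x z * adjacency E z x) = 0"
      using \<open>of_nat _ = 0\<close> by (simp add: common)
    ultimately show "(\<Sum>z\<in>V. adjacency E x z * adjacency E z y) = 0"
      if "y \<in> V" "adjacency E x y = 0" for y
      using that by (cases "x = y") (auto simp: of_nat_bit_eq_0_iff)
  qed
qed

section \<open>The chain complex of the surface\<close>

lemma bit_add_cancel_left: "(c + a) + (c + b) = a + (b :: bit)"
  by (cases a; cases b; cases c) simp_all

lemma bit_add_cancel_right: "(a + c) + (b + c) = a + (b :: bit)"
  by (cases a; cases b; cases c) simp_all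

locale framed_word = chord_word +
  fixes \<phi> :: "nat \<Rightarrow> frame"
  assumes nonempty: "w \<noteq> []" and framing: "\<phi> \<in> framings w"
begin

definition nx :: "nat \<Rightarrow> nat" where "nx i = Suc i mod m"

definition pv :: "nat \<Rightarrow> nat" where "pv i = (i + m - 1) mod m"

abbreviation "\<sigma> \<equiv> next_on_disc w \<phi> \<circ> across_band w"

lemma word_nonempty [simp]: "w \<noteq> []"
  by (rule nonempty)

lemma last_less [simp]: "m - Suc 0 < m"
  by simp

lemma nx_less [simp]: "nx i < m" and pv_less [simp]: "pv i < m"
  by (simp_all add: nx_def pv_def)

lemma pv_Suc: "Suc i < m \<Longrightarrow> pv (Suc i) = i"
  by (simp add: pv_def)

lemma pv_0: "pv 0 = m - Suc 0"
  by (simp add: pv_def)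

lemma nx_pv [simp]:
  assumes "i < m"
  shows "nx (pv i) = i"
proof -
  have "nx (pv i) = Suc (i + m - 1) mod m"
    unfolding nx_def pv_def by (rule mod_Suc_eq)
  also have "Suc (i + m - 1) = i + m" using assms by linarith
  finally show ?thesis using assms by simp
qed

lemma pv_nx [simp]:
  assumes "i < m"
  shows "pv (nx i) = i"
proof (cases "Suc i < m")
  case True
  then show ?thesis by (simp add: pv_Suc nx_def)
next
  case False
  with assms have "m = Suc i" by simp
  then show ?thesis by (simp add: pv_def nx_def)
qed

lemma frame_opp_neq:
  assumes "i < m"
  shows "\<phi> (opp i) \<noteq> \<phi> i"
proof -
  have "\<forall>i<m. \<forall>j<m. i \<noteq> j \<and> w ! i = w ! j \<longrightarrow> \<phi> i \<noteq> \<phi> j"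
    using framing by (simp add: framings_def)
  from this[rule_format, OF opp_less[OF assms] assms] assms show ?thesis
    by simp
qed

lemma frame_opp: "i < m \<Longrightarrow> \<phi> (opp i) = Zero \<longleftrightarrow> \<phi> i = Infinity"
  using frame_opp_neq[of i] by (cases "\<phi> i"; cases "\<phi> (opp i)") simp_all

lemma frame_opp': "i < m \<Longrightarrow> \<phi> (opp i) = Infinity \<longleftrightarrow> \<phi> i = Zero"
  using frame_opp_neq[of i] by (cases "\<phi> i"; cases "\<phi> (opp i)") simp_all

lemma frame_cases [case_names Infinity Zero]:
  assumes "i < m"
  obtains "\<phi> i = Infinity" "\<phi> (opp i) = Zero" | "\<phi> i = Zero" "\<phi> (opp i) = Infinity"
  using frame_opp[OF assms] frame_opp'[OF assms] by (cases "\<phi> i") auto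

lemma intervals_iff [simp]: "Plus i \<in> intervals w \<longleftrightarrow> i < m" "Minus i \<in> intervals w \<longleftrightarrow> i < m"
  by (auto simp: intervals_def)

lemma intervals_cases [consumes 1, case_names Plus Minus]:
  assumes "a \<in> intervals w"
  obtains i where "i < m" "a = Plus i" | i where "i < m" "a = Minus i"
  using assms by (auto simp: intervals_def)

lemma finite_intervals: "finite (intervals w)"
  by (simp add: intervals_def)

lemma across_band_simps: "across_band w (Plus i) = Minus (nx i)" "across_band w (Minus i) = Plus (pv i)"
  by (simp_all add: nx_def pv_def)

lemma across_mem: "a \<in> intervals w \<Longrightarrow> across_band w a \<in> intervals w"
  by (cases a) (simp_all del: across_band.simps add: across_band_simps)

lemma across_across: "a \<in> intervals w \<Longrightarrow> across_band w (across_band w a) = a"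
  by (cases a) (simp_all del: across_band.simps add: across_band_simps)

lemma next_mem: "a \<in> intervals w \<Longrightarrow> next_on_disc w \<phi> a \<in> intervals w"
  by (cases a) (auto split: frame.split)

lemma opp_inj: "i < m \<Longrightarrow> j < m \<Longrightarrow> opp i = opp j \<Longrightarrow> i = j"
  by (metis opp_opp)

lemma inj_next: "inj_on (next_on_disc w \<phi>) (intervals w)"
proof (rule inj_onI)
  fix a b assume "a \<in> intervals w" "b \<in> intervals w" "next_on_disc w \<phi> a = next_on_disc w \<phi> b"
  then show "a = b"
    by (cases a; cases b) (auto split: frame.splits dest: opp_inj)
qed

lemma bij_step: "bij_betw \<sigma> (intervals w) (intervals w)"
proof -
  have "inj_on (across_band w) (intervals w)"
    using across_across by (metis inj_onI)
  moreover have "across_band w ` intervals w \<subseteq> intervals w"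
    using across_mem by auto
  ultimately have inj: "inj_on \<sigma> (intervals w)"
    by (intro comp_inj_on) (auto intro: inj_on_subset[OF inj_next])
  have "\<sigma> ` intervals w \<subseteq> intervals w"
    using across_mem next_mem by auto
  from endo_inj_surj[OF finite_intervals this inj] inj show ?thesis
    by (simp add: bij_betw_def)
qed

text \<open>
  A face of the surface is an orbit of intervals. The set of faces where a face function is 1
  is a 2-chain; \<open>sides\<close> is its boundary, the set of bands whose two sides carry different values.
  In \<open>cycles\<close>, band \<open>i\<close> leads from position \<open>i\<close> to the next one; the four bands \<open>i\<close>, \<open>pv i\<close>, \<open>opp i\<close>,
  \<open>pv (opp i)\<close> are those at a disc.
\<close>

definition face_functions :: "(interval \<Rightarrow> bit) set" where
  "face_functions = {h \<in> intervals w \<rightarrow>\<^sub>E UNIV. \<forall>a\<in>intervals w. h (\<sigma> a) = h a}"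

definition sides :: "(interval \<Rightarrow> bit) \<Rightarrow> nat \<Rightarrow> bit" where
  "sides h = (\<lambda>i\<in>{..<m}. h (Plus i) + h (Minus (nx i)))"

definition cycles :: "(nat \<Rightarrow> bit) set" where
  "cycles = {S \<in> {..<m} \<rightarrow>\<^sub>E UNIV. \<forall>i<m. S i + S (pv i) = S (opp i) + S (pv (opp i))}"

lemma cyclesI:
  assumes "S \<in> {..<m} \<rightarrow>\<^sub>E UNIV" "\<And>i. i < m \<Longrightarrow> S i + S (pv i) = S (opp i) + S (pv (opp i))"
  shows "S \<in> cycles"
  unfolding cycles_def by (intro CollectI conjI allI impI assms)

lemma cycles_extensional: "S \<in> cycles \<Longrightarrow> S \<in> {..<m} \<rightarrow>\<^sub>E UNIV"
  unfolding cycles_def by (elim CollectE conjE)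

lemma cyclesD:
  "S \<in> cycles \<Longrightarrow> i < m \<Longrightarrow> S i + S (pv i) = S (opp i) + S (pv (opp i))"
  unfolding cycles_def by (elim CollectE conjE allE impE)

lemma card_face_functions: "card face_functions = 2 ^ boundary_components w \<phi>"
  unfolding face_functions_def
  using card_invariant_functions[OF finite_intervals bij_step] nonempty by (simp add: boundary_components_def)

text \<open>Exactly one occurrence of each chord is framed by \<open>Infinity\<close>, so each disc
  is listed once; its four equations belong to the four corners between neighbouring intervals on
  its boundary.\<close>

lemma face_functions_iff:
  assumes "h \<in> intervals w \<rightarrow>\<^sub>E UNIV"
  shows "h \<in> face_functions \<longleftrightarrow>
    (\<forall>j<m. \<phi> j = Infinity \<longrightarrow>
       h (Minus (opp j)) = h (Plus (pv j)) \<and> h (Plus (opp j)) = h (Minus (nx j)) \<and>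
       h (Plus j) = h (Plus (pv (opp j))) \<and> h (Minus j) = h (Minus (nx (opp j))))"
    (is "_ \<longleftrightarrow> ?R")
proof -
  have "h \<in> face_functions \<longleftrightarrow> (\<forall>a\<in>intervals w. h (next_on_disc w \<phi> a) = h (across_band w a))"
  proof -
    \<comment> \<open>\<open>across_band\<close> is an involution on the intervals, so it may be
      substituted for the variable; it then cancels inside \<open>\<sigma>\<close>.\<close>
    have "(\<forall>a\<in>intervals w. h (\<sigma> a) = h a) \<longleftrightarrow> (\<forall>a\<in>intervals w. h (\<sigma> (across_band w a)) = h (across_band w a))"
      using across_mem across_across by metis
    also have "\<dots> \<longleftrightarrow> (\<forall>a\<in>intervals w. h (next_on_disc w \<phi> a) = h (across_band w a))"
      using across_across by simp
    finally show ?thesis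
      using assms by (simp add: face_functions_def)
  qed
  also have "\<dots> \<longleftrightarrow> (\<forall>j<m. h (next_on_disc w \<phi> (Plus j)) = h (Minus (nx j)) \<and>
      h (next_on_disc w \<phi> (Minus j)) = h (Plus (pv j)))"
    by (auto simp: intervals_def across_band_simps simp del: next_on_disc.simps across_band.simps)
  also have "\<dots> \<longleftrightarrow> ?R"
  proof
    assume L: "\<forall>j<m. h (next_on_disc w \<phi> (Plus j)) = h (Minus (nx j)) \<and>
      h (next_on_disc w \<phi> (Minus j)) = h (Plus (pv j))"
    show ?R
    proof (intro allI impI)
      fix j assume j: "j < m" "\<phi> j = Infinity"
      then have "\<phi> (opp j) = Zero" by (simp add: frame_opp)
      then show "h (Minus (opp j)) = h (Plus (pv j)) \<and> h (Plus (opp j)) = h (Minus (nx j)) \<and>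
       h (Plus j) = h (Plus (pv (opp j))) \<and> h (Minus j) = h (Minus (nx (opp j)))"
        using L[rule_format, OF j(1)] L[rule_format, OF opp_less[OF j(1)]] j by simp
    qed
  next
    assume R: ?R
    show "\<forall>j<m. h (next_on_disc w \<phi> (Plus j)) = h (Minus (nx j)) \<and>
      h (next_on_disc w \<phi> (Minus j)) = h (Plus (pv j))"
    proof (intro allI impI)
      fix j assume j: "j < m"
      from j show "h (next_on_disc w \<phi> (Plus j)) = h (Minus (nx j)) \<and>
        h (next_on_disc w \<phi> (Minus j)) = h (Plus (pv j))"
      proof (cases rule: frame_cases)
        case Infinity
        with R j show ?thesis by simp
      next
        case Zero
        with R[rule_format, of "opp j"] j show ?thesis by simp
      qed
    qed
  qed
  finally show ?thesis .
qed

lemma face_functionsD: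
  assumes "h \<in> face_functions" "j < m" "\<phi> j = Infinity"
  shows "h (Minus (opp j)) = h (Plus (pv j))" "h (Plus (opp j)) = h (Minus (nx j))"
    "h (Plus j) = h (Plus (pv (opp j)))" "h (Minus j) = h (Minus (nx (opp j)))"
proof -
  have "h \<in> intervals w \<rightarrow>\<^sub>E UNIV"
    using assms(1) by (simp add: face_functions_def)
  from face_functions_iff[OF this] assms
  show "h (Minus (opp j)) = h (Plus (pv j))" "h (Plus (opp j)) = h (Minus (nx j))"
    "h (Plus j) = h (Plus (pv (opp j)))" "h (Minus j) = h (Minus (nx (opp j)))"
    by blast+
qed

lemma face_functions_add:
  assumes "h \<in> face_functions" "k \<in> face_functions"
  shows "(\<lambda>a\<in>intervals w. h a + k a) \<in> face_functions"
  using assms bij_betwE[OF bij_step] unfolding face_functions_def by (auto simp del: o_apply)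

lemma sides_add:
  "sides (\<lambda>a\<in>intervals w. h a + k a) = (\<lambda>i\<in>{..<m}. sides h i + sides k i)"
  by (auto simp: sides_def algebra_simps)

text \<open>The boundary of a boundary vanishes: at a disc the four corner equations match the four
  terms on the left with the four on the right. By symmetry it suffices to take the occurrence
  framed by \<open>Infinity\<close>.\<close>

lemma sides_in_cycles:
  assumes h: "h \<in> face_functions"
  shows "sides h \<in> cycles"
proof -
  have inf: "sides h j + sides h (pv j) = sides h (opp j) + sides h (pv (opp j))"
    if j: "j < m" "\<phi> j = Infinity" for j
  proof -
    have sides: "sides h i = h (Plus i) + h (Minus (nx i))" "sides h (pv i) = h (Plus (pv i)) + h (Minus i)"
      if "i < m" for i
      using that by (simp_all add: sides_def)
    show ?thesis
      unfolding sides[OF j(1)] sides[OF opp_less[OF j(1)]] face_functionsD[OF h j] by (simp only: ac_simps)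
  qed
  have "sides h i + sides h (pv i) = sides h (opp i) + sides h (pv (opp i))" if "i < m" for i
    using that
  proof (cases rule: frame_cases)
    case Infinity
    with that show ?thesis by (intro inf)
  next
    case Zero
    from inf[OF opp_less[OF that] Zero(2)] show ?thesis
      unfolding opp_opp[OF that] by (rule sym)
  qed
  then show ?thesis
    by (intro cyclesI) (simp add: sides_def)
qed

lemma cyclic_const:
  assumes "\<And>i. i < m \<Longrightarrow> p (pv i) = p i" and "i < m"
  shows "p i = p 0"
  using assms(2)
proof (induction i)
  case (Suc i)
  have "p (Suc i) = p i"
    using assms(1)[OF Suc.prems] unfolding pv_Suc[OF Suc.prems] by (rule sym)
  also have "\<dots> = p 0"
    using Suc by simp
  finally show ?case .
qed simp

text \<open>Without jumps the value is the same on both sides of each band, and the corner equations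
  then carry it from each band to the next, hence along the whole curve.\<close>

lemma sides_eq_0_imp_const:
  assumes h: "h \<in> face_functions" and zero: "\<And>i. i < m \<Longrightarrow> sides h i = 0" and a: "a \<in> intervals w"
  shows "h a = h (Plus 0)"
proof -
  have side: "h (Minus (nx i)) = h (Plus i)" if "i < m" for i
    using zero[OF that] that by (simp add: sides_def bit_add_eq_0_iff)
  have inf: "h (Plus (pv j)) = h (Plus j) \<and> h (Plus (pv (opp j))) = h (Plus (opp j))"
    if j: "j < m" "\<phi> j = Infinity" for j
    using face_functionsD[OF h j] side[OF j(1)] side[of "pv (opp j)"] nx_pv[OF opp_less[OF j(1)]]
    by simp
  have const: "h (Plus i) = h (Plus 0)" if "i < m" for i
  proof (rule cyclic_const[of "\<lambda>i. h (Plus i)", OF _ that])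
    fix i assume i: "i < m"
    then show "h (Plus (pv i)) = h (Plus i)"
    proof (cases rule: frame_cases)
      case Infinity
      from inf[OF i Infinity(1)] show ?thesis by (rule conjunct1)
    next
      case Zero
      from inf[OF opp_less[OF i] Zero(2)] show ?thesis
        unfolding opp_opp[OF i] by (rule conjunct2)
    qed
  qed
  show ?thesis
    using a
  proof (cases rule: intervals_cases)
    case (Plus i)
    show ?thesis
      unfolding Plus(2) by (rule const[OF Plus(1)])
  next
    case (Minus i)
    then have "h a = h (Plus (pv i))"
      using side[of "pv i"] by simp
    also have "\<dots> = h (Plus 0)"
      by (rule const) simp
    finally show ?thesis .
  qed
qed

text \<open>The kernel of \<open>sides\<close> consists of the two constants, because the curve meets every disc.\<close>

lemma card_sides_image: "2 ^ boundary_components w \<phi> = 2 * card (sides ` face_functions)"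
proof -
  have fin: "finite face_functions"
    by (rule card_ge_0_finite) (simp add: card_face_functions)
  have "card {h \<in> face_functions. sides h = S} = 2" if "S \<in> sides ` face_functions" for S
  proof -
    from that obtain h where h: "h \<in> face_functions" "S = sides h" by blast
    let ?t = "\<lambda>c. \<lambda>a\<in>intervals w. h a + c :: bit"
    have "{k \<in> face_functions. sides k = S} = ?t ` UNIV"
    proof (intro equalityI subsetI)
      fix k assume k: "k \<in> {k \<in> face_functions. sides k = S}"
      let ?d = "\<lambda>a\<in>intervals w. h a + k a"
      have "?d \<in> face_functions"
        using h k by (intro face_functions_add) auto
      moreover have "sides ?d i = 0" if "i < m" for i
        using h k that by (simp add: sides_add)
      ultimately have d: "?d a = ?d (Plus 0)" if "a \<in> intervals w" for a
        by (rule sides_eq_0_imp_const[OF _ _ that])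
      have "k = ?t (?d (Plus 0))"
      proof
        fix a show "k a = ?t (?d (Plus 0)) a"
        proof (cases "a \<in> intervals w")
          case True
          then have "k a = h a + ?d a" by simp
          with True show ?thesis unfolding d[OF True] by simp
        next
          case False
          with k show ?thesis by (auto simp: face_functions_def PiE_def extensional_def)
        qed
      qed
      then show "k \<in> ?t ` UNIV" by blast
    next
      fix k assume "k \<in> ?t ` UNIV"
      then obtain c where k: "k = ?t c" by blast
      have "k \<in> face_functions"
        using h(1) bij_betwE[OF bij_step] unfolding k face_functions_def by (simp del: o_apply)
      moreover have "sides k = sides h"
        unfolding k sides_def by (intro restrict_ext) (simp add: bit_add_cancel_right)
      ultimately show "k \<in> {k \<in> face_functions. sides k = S}"
        using h by simp
    qed
    moreover have "inj ?t"
    proof (rule injI)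
      fix c d assume "?t c = ?t d"
      from fun_cong[OF this, of "Plus 0"] show "c = d" by simp
    qed
    ultimately show ?thesis by (simp add: card_image)
  qed
  from card_fibres_eq[OF fin this] show ?thesis
    using card_face_functions by simp
qed

section \<open>Arcs and the whole curve as a basis of the cycles\<close>

definition arc :: "'a \<Rightarrow> nat \<Rightarrow> bit" where
  "arc x = (\<lambda>i\<in>{..<m}. of_bool (first x \<le> i \<and> i < second x))"

lemma arc_last:
  assumes "x \<in> V"
  shows "arc x (m - 1) = 0"
  using second_less[OF assms] by (auto simp: arc_def)

text \<open>Band \<open>i\<close> starts at position \<open>i\<close>, so the arc is half-open and
  jumps exactly at the two occurrences of \<open>x\<close>. At position 0 the preceding band is the
  last one, which lies in no arc.\<close>

lemma arc_difference:
  assumes "x \<in> V" "i < m"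
  shows "arc x i + arc x (pv i) = of_bool (i = first x) + of_bool (i = second x)"
proof (cases i)
  case 0
  then have "pv i = m - 1" by (simp add: pv_0)
  with arc_last[OF assms(1)] first_less_second[OF assms(1)] assms(2) 0 show ?thesis
    by (auto simp: arc_def)
next
  case (Suc j)
  with assms(2) have "pv i = j" by (simp add: pv_Suc)
  with Suc first_less_second[OF assms(1)] assms(2) show ?thesis
    by (auto simp: arc_def)
qed

text \<open>A function on the bands is determined by its jumps and one value. The last band serves
  as base point because all arcs vanish there.\<close>

lemma eq_of_difference_eq:
  fixes S T :: "nat \<Rightarrow> bit"
  assumes "\<And>i. i < m \<Longrightarrow> S i + S (pv i) = T i + T (pv i)" "S (m - 1) = T (m - 1)" "i < m"
  shows "S i = T i"
proof -
  have step: "S (pv i) + T (pv i) = S i + T i" if "i < m" for i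
    using assms(1)[OF that] by (cases "S i"; cases "T i"; cases "S (pv i)"; cases "T (pv i)") simp_all
  have const: "S i + T i = S 0 + T 0" if "i < m" for i
    by (rule cyclic_const[of "\<lambda>i. S i + T i", OF step that])
  from const[OF assms(3)] const[of "m - 1"] assms(2) show ?thesis
    by (simp add: bit_add_eq_0_iff)
qed

definition combination :: "bit \<times> ('a \<Rightarrow> bit) \<Rightarrow> nat \<Rightarrow> bit" where
  "combination = (\<lambda>(c, T). \<lambda>i\<in>{..<m}. c + (\<Sum>x\<in>V. T x * arc x i))"

lemma combination_difference:
  assumes "i < m"
  shows "combination (c, T) i + combination (c, T) (pv i) = T (w ! i)"
proof -
  have wi: "w ! i \<in> V" using assms by simp
  have "combination (c, T) i + combination (c, T) (pv i)
      = (\<Sum>x\<in>V. T x * arc x i) + (\<Sum>x\<in>V. T x * arc x (pv i))"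
    using assms by (simp add: combination_def bit_add_cancel_left)
  also have "\<dots> = (\<Sum>x\<in>V. T x * (arc x i + arc x (pv i)))"
    by (simp add: sum.distrib distrib_left)
  also have "\<dots> = (\<Sum>x\<in>V. if x = w ! i then T x else 0)"
  proof (rule sum.cong[OF refl])
    fix x assume x: "x \<in> V"
    show "T x * (arc x i + arc x (pv i)) = (if x = w ! i then T x else 0)"
    proof (cases "x = w ! i")
      case True
      then have "(i = first x) \<noteq> (i = second x)"
        using position_cases[OF assms] first_neq_second[OF x x] by metis
      with True show ?thesis
        unfolding arc_difference[OF x assms] by (cases "i = first x") simp_all
    next
      case False
      then have "i \<noteq> first x" "i \<noteq> second x"
        using nth_first[OF x] nth_second[OF x] by metis+
      with False show ?thesis
        unfolding arc_difference[OF x assms] by simp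
    qed
  qed
  also have "\<dots> = T (w ! i)" using wi by simp
  finally show ?thesis .
qed

text \<open>A cycle jumps equally at the two occurrences of a letter, so it amounts to one jump per
  letter and its value on the last band. These are the coordinates \<open>T\<close> and
  \<open>c\<close>, because an arc jumps only at its own letter.\<close>

lemma bij_combination: "bij_betw combination (UNIV \<times> (V \<rightarrow>\<^sub>E UNIV)) cycles"
proof (rule bij_betw_byWitness[where f' = "\<lambda>S. (S (m - 1), \<lambda>x\<in>V. S (first x) + S (pv (first x)))"])
  let ?f' = "\<lambda>S. (S (m - 1), \<lambda>x\<in>V. S (first x) + S (pv (first x)))"
  have last: "combination (c, T) (m - 1) = c" for c T
    using arc_last by (simp add: combination_def)
  show "\<forall>a\<in>UNIV \<times> (V \<rightarrow>\<^sub>E UNIV). ?f' (combination a) = a"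
  proof
    fix a :: "bit \<times> ('a \<Rightarrow> bit)" assume a: "a \<in> UNIV \<times> (V \<rightarrow>\<^sub>E UNIV)"
    obtain c T where cT: "a = (c, T)" by (cases a)
    have "(\<lambda>x\<in>V. combination a (first x) + combination a (pv (first x))) = T"
    proof
      fix x show "(\<lambda>x\<in>V. combination a (first x) + combination a (pv (first x))) x = T x"
      proof (cases "x \<in> V")
        case True
        then show ?thesis
          unfolding cT by (simp add: combination_difference)
      next
        case False
        with a show ?thesis
          unfolding cT by (auto simp: PiE_def extensional_def)
      qed
    qed
    then show "?f' (combination a) = a"
      unfolding cT using last[of c T] by simp
  qed
  show "\<forall>S\<in>cycles. combination (?f' S) = S"
  proof (intro ballI ext)
    fix S i assume S: "S \<in> cycles"
    show "combination (?f' S) i = S i"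
    proof (cases "i < m")
      case True
      then show ?thesis
      proof (rule eq_of_difference_eq[rotated 2])
        show "combination (?f' S) (m - 1) = S (m - 1)"
          by (rule last)
        fix i assume i: "i < m"
        \<comment> \<open>At a second occurrence the cycle condition replaces the jump by the one at
          the first.\<close>
        have "S (first (w ! i)) + S (pv (first (w ! i))) = S i + S (pv i)"
        proof (cases "i = first (w ! i)")
          case True
          from this[symmetric] show ?thesis by (simp only:)
        next
          case False
          then have "second (w ! i) = i" using position_cases[OF i] by metis
          then have "opp i = first (w ! i)" using i opp_second[of "w ! i"] by (simp only: nth_mem)
          from cyclesD[OF S i, unfolded this] show ?thesis by (rule sym)
        qed
        then show "combination (?f' S) i + combination (?f' S) (pv i) = S i + S (pv i)"
          unfolding combination_difference[OF i] restrict_apply'[OF nth_mem[OF i]] .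
      qed
    next
      case False
      then have "S i = undefined"
        using PiE_arb[OF cycles_extensional[OF S]] by simp
      with False show ?thesis by (simp add: combination_def)
    qed
  qed
  show "combination ` (UNIV \<times> (V \<rightarrow>\<^sub>E UNIV)) \<subseteq> cycles"
  proof safe
    fix c and T :: "'a \<Rightarrow> bit"
    show "combination (c, T) \<in> cycles"
    proof (rule cyclesI)
      fix i assume "i < m"
      then show "combination (c, T) i + combination (c, T) (pv i) =
          combination (c, T) (opp i) + combination (c, T) (pv (opp i))"
        using combination_difference[of i c T] combination_difference[of "opp i" c T] by simp
    qed (simp add: combination_def)
  qed
qed auto

lemma card_cycles: "card cycles = 2 * 2 ^ card V"
  using bij_betw_same_card[OF bij_combination] by (simp add: card_cartesian_product card_funcsetE)

lemma finite_cycles: "finite cycles"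
  by (rule card_ge_0_finite) (simp add: card_cycles)

text \<open>Genus 0 means that the first homology modulo 2 of the surface vanishes.\<close>

lemma genus_0_iff_sides: "has_genus w \<phi> 0 \<longleftrightarrow> sides ` face_functions = cycles"
proof -
  have sub: "sides ` face_functions \<subseteq> cycles"
    using sides_in_cycles by blast
  have "has_genus w \<phi> 0 \<longleftrightarrow> boundary_components w \<phi> = card V + 2"
    unfolding has_genus_def by auto
  also have "\<dots> \<longleftrightarrow> (2 :: nat) ^ boundary_components w \<phi> = 2 ^ (card V + 2)"
    by (rule power_inject_exp[symmetric]) simp
  also have "\<dots> \<longleftrightarrow> card (sides ` face_functions) = card cycles"
    unfolding card_sides_image card_cycles by (simp add: power_add)
  also have "\<dots> \<longleftrightarrow> sides ` face_functions = cycles"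
    using card_subset_eq[OF finite_cycles sub] by auto
  finally show ?thesis .
qed

lemma sides_image_add:
  assumes "S \<in> sides ` face_functions" "T \<in> sides ` face_functions"
  shows "(\<lambda>i\<in>{..<m}. S i + T i) \<in> sides ` face_functions"
proof -
  from assms obtain h k where "h \<in> face_functions" "k \<in> face_functions" "S = sides h" "T = sides k"
    by blast
  then show ?thesis
    by (simp only: sides_add[symmetric] face_functions_add imageI)
qed

lemma sides_image_0: "(\<lambda>i\<in>{..<m}. 0) \<in> sides ` face_functions"
proof (rule image_eqI)
  show "(\<lambda>a\<in>intervals w. 0) \<in> face_functions"
    using bij_betwE[OF bij_step] by (auto simp: face_functions_def simp del: o_apply)
  show "(\<lambda>i\<in>{..<m}. 0) = sides (\<lambda>a\<in>intervals w. 0)"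
    by (auto simp: sides_def)
qed

lemma arc_in_cycles:
  assumes x: "x \<in> V"
  shows "arc x \<in> cycles"
proof -
  have "arc x i + arc x (pv i) = arc x (opp i) + arc x (pv (opp i))" if i: "i < m" for i
  proof -
    have "opp i = first x \<longleftrightarrow> i = second x" "opp i = second x \<longleftrightarrow> i = first x"
      using opp_first[OF x] opp_second[OF x] opp_opp[OF i] by metis+
    then show ?thesis
      unfolding arc_difference[OF x i] arc_difference[OF x opp_less[OF i]] by (simp add: add.commute)
  qed
  then show ?thesis
    by (intro cyclesI) (simp add: arc_def)
qed

text \<open>Bounding cycles are closed under addition, so by \<open>bij_combination\<close> all
  cycles bound as soon as the whole curve and the arcs do.\<close>

lemma genus_0_iff_generators:
  "has_genus w \<phi> 0 \<longleftrightarrow> (\<lambda>i\<in>{..<m}. 1) \<in> sides ` face_functions \<and> (\<forall>x\<in>V. arc x \<in> sides ` face_functions)"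
  unfolding genus_0_iff_sides
proof
  assume eq: "sides ` face_functions = cycles"
  have "(\<lambda>i\<in>{..<m}. 1) \<in> cycles"
    by (auto simp: cycles_def)
  moreover have "arc x \<in> cycles" if "x \<in> V" for x
    by (rule arc_in_cycles[OF that])
  ultimately show "(\<lambda>i\<in>{..<m}. 1) \<in> sides ` face_functions \<and> (\<forall>x\<in>V. arc x \<in> sides ` face_functions)"
    unfolding eq by (intro conjI ballI)
next
  assume gen: "(\<lambda>i\<in>{..<m}. 1) \<in> sides ` face_functions \<and> (\<forall>x\<in>V. arc x \<in> sides ` face_functions)"
  have restrict_add: "(\<lambda>i\<in>{..<m}. (\<lambda>i\<in>{..<m}. f i) i + (\<lambda>i\<in>{..<m}. g i) i) = (\<lambda>i\<in>{..<m}. f i + g i)"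
    for f g :: "nat \<Rightarrow> bit"
    by (rule restrict_ext) simp
  have scale: "(\<lambda>i\<in>{..<m}. c * S i) \<in> sides ` face_functions" if S: "S \<in> sides ` face_functions" for c S
  proof (cases c)
    case zero
    show ?thesis
      unfolding zero mult_zero_left by (rule sides_image_0)
  next
    case one
    have "(\<lambda>i\<in>{..<m}. S i) = S"
      using S by (auto simp: sides_def)
    then show ?thesis
      unfolding one mult_1 using S by (simp only:)
  qed
  have "combination (c, T) \<in> sides ` face_functions" for c T
  proof -
    have sum: "(\<lambda>i\<in>{..<m}. \<Sum>x\<in>A. T x * arc x i) \<in> sides ` face_functions" if "finite A" "A \<subseteq> V" for A
      using that
    proof (induction A rule: finite_induct)
      case empty
      show ?case
        unfolding sum.empty by (rule sides_image_0)
    next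
      case (insert x A)
      then have 1: "(\<lambda>i\<in>{..<m}. T x * arc x i) \<in> sides ` face_functions"
        using gen by (intro scale) auto
      have 2: "(\<lambda>i\<in>{..<m}. \<Sum>x\<in>A. T x * arc x i) \<in> sides ` face_functions"
        using insert.prems by (intro insert.IH) simp
      from sides_image_add[OF 1 2]
      show ?case
        unfolding sum.insert[OF insert.hyps] restrict_add .
    qed
    have "(\<lambda>i\<in>{..<m}. c * (\<lambda>i\<in>{..<m}. 1) i) \<in> sides ` face_functions"
      using gen by (intro scale) blast
    also have "(\<lambda>i\<in>{..<m}. c * (\<lambda>i\<in>{..<m}. 1) i) = (\<lambda>i\<in>{..<m}. c)"
      by (rule restrict_ext) simp
    finally have "(\<lambda>i\<in>{..<m}. c) \<in> sides ` face_functions" .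
    from sides_image_add[OF this sum[of V]] show ?thesis
      by (simp only: combination_def prod.case restrict_add finite_set subset_refl)
  qed
  then have "combination ` (UNIV \<times> (V \<rightarrow>\<^sub>E UNIV)) \<subseteq> sides ` face_functions"
    by (intro image_subsetI) (simp only: split_paired_all)
  then show "sides ` face_functions = cycles"
    unfolding bij_betw_imp_surj_on[OF bij_combination]
    by (intro equalityI image_subsetI sides_in_cycles)
qed

end

section \<open>Bounding cycles\<close>

context framed_word
begin

text \<open>
  The value of \<open>S\<close> on the half of the crossing strand that lies, at position \<open>k\<close>, on the side of the
  curve given by the intervals \<open>Plus i\<close>. If \<open>S\<close> bounds, this is the jump at \<open>k\<close> of the face function
  on that side, so face functions are recovered as partial sums of \<open>crossing S\<close>.
\<close>

definition crossing :: "(nat \<Rightarrow> bit) \<Rightarrow> nat \<Rightarrow> bit" where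
  "crossing S k = (if \<phi> k = Infinity then S (pv (opp k)) else S (opp k))"

lemma crossing_sides:
  assumes h: "h \<in> face_functions" and i: "i < m"
  shows "crossing (sides h) i = h (Plus i) + h (Plus (pv i))"
  using i
proof (cases rule: frame_cases)
  case Infinity
  have "crossing (sides h) i = h (Plus (pv (opp i))) + h (Minus (opp i))"
    using Infinity(1) i by (simp add: crossing_def sides_def)
  then show ?thesis
    unfolding face_functionsD(1)[OF h i Infinity(1)] face_functionsD(3)[OF h i Infinity(1)] .
next
  case Zero
  have "crossing (sides h) i = h (Plus (opp i)) + h (Minus (nx (opp i)))"
    using Zero(1) i by (simp add: crossing_def sides_def)
  then show ?thesis
    using face_functionsD(2,3)[OF h opp_less[OF i] Zero(2)] unfolding opp_opp[OF i] by (metis add.commute)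
qed

text \<open>The jumps telescope, starting from the last band, which precedes position 0. The bound
  \<open>Suc i\<close> includes the jump at \<open>i\<close> itself.\<close>

lemma sum_crossing_sides:
  assumes h: "h \<in> face_functions"
  shows "i < m \<Longrightarrow> (\<Sum>k<Suc i. crossing (sides h) k) = h (Plus i) + h (Plus (m - Suc 0))"
proof (induction i)
  case 0
  then show ?case
    using crossing_sides[OF h 0] by (simp add: pv_0)
next
  case (Suc i)
  have "(\<Sum>k<Suc (Suc i). crossing (sides h) k)
      = (h (Plus i) + h (Plus (m - Suc 0))) + (h (Plus (Suc i)) + h (Plus i))"
    unfolding sum.lessThan_Suc[of _ "Suc i"] crossing_sides[OF h Suc.prems] pv_Suc[OF Suc.prems]
    using Suc by simp
  then show ?case by (simp add: ac_simps)
qed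

lemma sum_crossing_sides':
  assumes "h \<in> face_functions" "i < m"
  shows "(\<Sum>k<i. crossing (sides h) k) = h (Plus (pv i)) + h (Plus (m - Suc 0))"
proof (cases i)
  case 0
  then show ?thesis by (simp add: pv_0)
next
  case (Suc j)
  with assms show ?thesis
    using sum_crossing_sides[OF assms(1), of j] pv_Suc[of j] by (simp del: sum.lessThan_Suc)
qed

text \<open>A face function with boundary \<open>S\<close> arises by integrating the crossings along
  the curve. The total must vanish for the integral to close up; the equality at \<open>a\<close> is
  the corner equation for \<open>h (Plus a)\<close>, and the other three corners follow from it and
  the cycle condition.\<close>

lemma sides_image_iff_sums:
  assumes S: "S \<in> cycles"
  shows "S \<in> sides ` face_functions \<longleftrightarrow> (\<Sum>k<m. crossing S k) = 0 \<and>
    (\<forall>a<m. \<phi> a = Infinity \<longrightarrow> (\<Sum>k<Suc a. crossing S k) = (\<Sum>k<opp a. crossing S k))"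
proof
  assume "S \<in> sides ` face_functions"
  then obtain h where h: "h \<in> face_functions" "S = sides h" by blast
  have "(\<Sum>k<Suc (m - Suc 0). crossing S k) = 0"
    unfolding h(2) sum_crossing_sides[OF h(1) last_less] by simp
  then have "(\<Sum>k<m. crossing S k) = 0"
    by (simp del: sum.lessThan_Suc)
  moreover have "(\<Sum>k<Suc a. crossing S k) = (\<Sum>k<opp a. crossing S k)" if "a < m" "\<phi> a = Infinity" for a
    unfolding h(2) sum_crossing_sides[OF h(1) that(1)] sum_crossing_sides'[OF h(1) opp_less[OF that(1)]]
      face_functionsD(3)[OF h(1) that] ..
  ultimately show "(\<Sum>k<m. crossing S k) = 0 \<and>
    (\<forall>a<m. \<phi> a = Infinity \<longrightarrow> (\<Sum>k<Suc a. crossing S k) = (\<Sum>k<opp a. crossing S k))"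
    by (intro conjI allI impI)
next
  assume R: "(\<Sum>k<m. crossing S k) = 0 \<and>
    (\<forall>a<m. \<phi> a = Infinity \<longrightarrow> (\<Sum>k<Suc a. crossing S k) = (\<Sum>k<opp a. crossing S k))"
  from R have total: "(\<Sum>k<m. crossing S k) = 0" by (rule conjunct1)
  define p where "p i = (\<Sum>k<Suc i. crossing S k)" for i
  \<comment> \<open>The \<open>Plus\<close> side carries the partial sums; the \<open>Minus\<close>
    side is forced by the requirement \<open>sides h = S\<close>.\<close>
  define h where "h = (\<lambda>a\<in>intervals w. case a of Plus i \<Rightarrow> p i | Minus i \<Rightarrow> p (pv i) + S (pv i))"
  have hP: "h (Plus i) = p i" and hM: "h (Minus i) = p (pv i) + S (pv i)" if "i < m" for i
    using that by (simp_all add: h_def)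
  have p_pv: "p (pv i) = (\<Sum>k<i. crossing S k)" if "i < m" for i
  proof (cases i)
    case 0
    have "p (pv 0) = (\<Sum>k<Suc (m - Suc 0). crossing S k)"
      by (simp only: p_def pv_0)
    with total 0 show ?thesis by (simp del: sum.lessThan_Suc)
  next
    case (Suc j)
    with that show ?thesis by (simp only: p_def pv_Suc)
  qed
  have p_step: "p i + p (pv i) = crossing S i" if "i < m" for i
    unfolding p_pv[OF that] by (simp add: p_def ac_simps)
  have ext: "h \<in> intervals w \<rightarrow>\<^sub>E UNIV"
    by (simp add: h_def)
  have "h \<in> face_functions"
    unfolding face_functions_iff[OF ext]
  proof (intro allI impI)
    fix j assume j: "j < m" "\<phi> j = Infinity"
    let ?b = "opp j"
    have b: "?b < m" "\<phi> ?b \<noteq> Infinity" using j frame_opp[OF j(1)] by auto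
    have 1: "p j = p (pv ?b)"
      unfolding p_pv[OF b(1)] unfolding p_def using conjunct2[OF R, rule_format, OF j] .
    have 2: "p j + p (pv j) = S (pv ?b)"
      unfolding p_step[OF j(1)] crossing_def using j by simp
    have 3: "p ?b + p (pv ?b) = S j"
      unfolding p_step[OF b(1)] crossing_def using b j by simp
    have 4: "S j + S (pv j) = S ?b + S (pv ?b)"
      by (rule cyclesD[OF S j(1)])
    \<comment> \<open>The conclusion lists three corner equations in bits; the remaining one is
      equation \<open>1\<close> itself.\<close>
    have bits: "b1 = s1 \<longrightarrow> b1 + b2 = s4 \<longrightarrow> b3 + s1 = s2 \<longrightarrow> s2 + s5 = s3 + s4 \<longrightarrow>
       s1 + s4 = b2 \<and> b3 = b1 + s2 \<and> b2 + s5 = b3 + s3"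
      for b1 b2 b3 s1 s2 s3 s4 s5 :: bit
      by (cases b1; cases b2; cases s2; cases s5) (auto simp: bit_add_eq_0_iff)
    show "h (Minus ?b) = h (Plus (pv j)) \<and> h (Plus ?b) = h (Minus (nx j)) \<and>
       h (Plus j) = h (Plus (pv ?b)) \<and> h (Minus j) = h (Minus (nx ?b))"
      unfolding hP[OF j(1)] hP[OF b(1)] hP[OF pv_less] hM[OF j(1)] hM[OF b(1)] hM[OF nx_less]
        pv_nx[OF j(1)] pv_nx[OF b(1)]
      using bits[rule_format, OF 1 2 3 4] 1 by (intro conjI) simp_all
  qed
  moreover have "sides h = S"
  proof
    fix i show "sides h i = S i"
    proof (cases "i < m")
      case True
      then have "sides h i = p i + (p i + S i)"
        by (simp only: sides_def restrict_apply' lessThan_iff hP hM nx_less pv_nx)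
      then show ?thesis by simp
    next
      case False
      then show ?thesis
        using PiE_arb[OF cycles_extensional[OF S]] by (simp add: sides_def)
    qed
  qed
  ultimately show "S \<in> sides ` face_functions" by blast
qed

lemma sum_inside_times:
  assumes "y \<in> V"
  shows "(\<Sum>k<m. inside y k * D k) = (\<Sum>k<Suc (first y). D k) + (\<Sum>k<second y. D k)"
proof -
  have "(\<Sum>k<m. inside y k * D k) = (\<Sum>k\<in>{Suc (first y)..<second y}. D k)"
    using second_less[OF assms] by (intro sum.mono_neutral_cong_right) (auto simp: inside_def)
  moreover have "(\<Sum>k<Suc (first y). D k) + (\<Sum>k\<in>{Suc (first y)..<second y}. D k) = (\<Sum>k<second y. D k)"
    unfolding lessThan_atLeast0 using first_less_second[OF assms] by (intro sum.atLeastLessThan_concat) simp_all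
  ultimately show ?thesis
    by (metis bit_add_left_self)
qed

text \<open>Exactly one of the two occurrences of \<open>y\<close> is framed by
  \<open>Infinity\<close> and gives a condition. If it is the first, the two prefix sums differ by
  the open arc; otherwise they differ by the closed arc, whence the two end terms.\<close>

lemma sides_image_iff:
  assumes S: "S \<in> cycles"
  shows "S \<in> sides ` face_functions \<longleftrightarrow> (\<Sum>k<m. crossing S k) = 0 \<and>
    (\<forall>y\<in>V. (\<Sum>k<m. inside y k * crossing S k)
      + (if \<phi> (first y) = Infinity then 0 else crossing S (first y) + crossing S (second y)) = 0)"
proof -
  let ?P = "\<lambda>j. \<Sum>k<j. crossing S k"
  let ?A = "\<lambda>a. \<phi> a = Infinity \<longrightarrow> ?P (Suc a) = ?P (opp a)"
  let ?B = "\<lambda>y. (\<Sum>k<m. inside y k * crossing S k)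
      + (if \<phi> (first y) = Infinity then 0 else crossing S (first y) + crossing S (second y)) = 0"
  have AB: "?A (first y) \<and> ?A (second y) \<longleftrightarrow> ?B y" if y: "y \<in> V" for y
  proof (cases rule: frame_cases[OF first_less[OF y]])
    case 1
    then show ?thesis
      unfolding sum_inside_times[OF y] opp_first[OF y]
      by (simp del: sum.lessThan_Suc add: bit_add_eq_0_iff)
  next
    case 2
    have "?P (Suc (second y)) = ?P (first y) \<longleftrightarrow>
        ?P (Suc (first y)) + ?P (second y) + (crossing S (first y) + crossing S (second y)) = 0"
    proof -
      have "d + d' = c \<longleftrightarrow> c + c' + d + (c' + d') = 0" for c c' d d' :: bit
        by (cases c; cases c'; cases d; cases d') simp_all
      then show ?thesis unfolding sum.lessThan_Suc .
    qed
    then show ?thesis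
      using 2 unfolding sum_inside_times[OF y] opp_first[OF y] opp_second[OF y] by simp
  qed
  have "(\<forall>a<m. ?A a) \<longleftrightarrow> (\<forall>y\<in>V. ?A (first y) \<and> ?A (second y))"
  proof
    assume R: "\<forall>y\<in>V. ?A (first y) \<and> ?A (second y)"
    show "\<forall>a<m. ?A a"
    proof (rule allI, rule impI)
      fix a assume a: "a < m"
      from R[rule_format, OF nth_mem[OF a]] position_cases[OF a] show "?A a" by metis
    qed
  next
    assume L: "\<forall>a<m. ?A a"
    show "\<forall>y\<in>V. ?A (first y) \<and> ?A (second y)"
    proof (rule ballI, rule conjI)
      fix y assume y: "y \<in> V"
      show "?A (first y)" by (rule mp[OF spec[OF L] first_less[OF y]])
      show "?A (second y)" by (rule mp[OF spec[OF L] second_less[OF y]])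
    qed
  qed
  also have "\<dots> \<longleftrightarrow> (\<forall>y\<in>V. ?B y)"
    using AB by (intro ball_cong refl)
  finally show ?thesis
    unfolding sides_image_iff_sums[OF S] by (rule conj_cong[OF refl])
qed

end

context chord_word
begin

text \<open>
  Both terms change from one occurrence of a letter to the other (the second one because degrees
  are even), so for a framing this is a function of the letter.
\<close>

definition potential :: "(nat \<Rightarrow> frame) \<Rightarrow> nat \<Rightarrow> bit" where
  "potential \<phi> i = of_bool (\<phi> i = Infinity) + of_nat i"

end

section \<open>The bounding equations of the whole curve and of the arcs\<close>

locale even_framed_word = framed_word + even_chord_word
begin

text \<open>All crossings are 1, so the conditions count all positions and the positions inside an
  arc; both numbers are even, and the two end terms cancel.\<close>

lemma one_in_sides: "(\<lambda>i\<in>{..<m}. 1) \<in> sides ` face_functions"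
proof -
  have cross: "crossing (\<lambda>i\<in>{..<m}. 1) k = 1" if "k < m" for k
    using that by (simp add: crossing_def)
  have "(\<Sum>k<m. crossing (\<lambda>i\<in>{..<m}. 1) k) = (\<Sum>k<m. 1)"
    by (intro sum.cong refl cross) simp
  also have "\<dots> = 0"
    using even_length by (simp add: of_nat_bit)
  finally have "(\<Sum>k<m. crossing (\<lambda>i\<in>{..<m}. 1) k) = 0" .
  moreover have "(\<Sum>k<m. inside y k * crossing (\<lambda>i\<in>{..<m}. 1) k) = 0" if "y \<in> V" for y
  proof -
    have "(\<Sum>k<m. inside y k * crossing (\<lambda>i\<in>{..<m}. 1) k) = (\<Sum>k<m. inside y k)"
      by (intro sum.cong) (simp_all add: cross)
    with sum_inside[OF that] show ?thesis by simp
  qed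
  moreover have "(\<lambda>i\<in>{..<m}. 1) \<in> cycles"
    by (rule cyclesI) simp_all
  ultimately show ?thesis
    by (simp add: sides_image_iff cross)
qed

text \<open>Away from its own chord the arc is constant through the disc, so only the place of
  \<open>opp k\<close> counts. At either occurrence of \<open>x\<close> the half strand on the
  \<open>Plus\<close> side belongs to the arc exactly when \<open>first x\<close> is framed by
  \<open>Infinity\<close>.\<close>

lemma crossing_arc:
  assumes x: "x \<in> V" and k: "k < m"
  shows "crossing (arc x) k = inside x (opp k) + of_bool (w ! k = x) * of_bool (\<phi> (first x) = Infinity)"
proof -
  have arc_first: "arc x (first x) = 1" and arc_second: "arc x (second x) = 0"
    using x by (simp_all add: arc_def)
  have pv_first: "arc x (pv (first x)) = 0"
    using arc_difference[OF x first_less[OF x]] arc_first first_neq_second[OF x x] by simp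
  have pv_second: "arc x (pv (second x)) = 1"
    using arc_difference[OF x second_less[OF x]] arc_second first_neq_second[OF x x] by simp
  consider "k = first x" | "k = second x" | "w ! k \<noteq> x"
    using position_cases[OF k] by metis
  then show ?thesis
  proof cases
    case 1
    then show ?thesis
      using x arc_second pv_second by (simp add: crossing_def)
  next
    case 2
    then show ?thesis
      using x arc_first pv_first frame_opp[OF first_less[OF x]] frame_opp'[OF first_less[OF x]]
      by (cases "\<phi> (second x)") (simp_all add: crossing_def)
  next
    case 3
    have neq: "opp k \<noteq> first x" "opp k \<noteq> second x"
      using 3 nth_opp[OF k] nth_first[OF x] nth_second[OF x] by metis+
    then have "arc x (pv (opp k)) = arc x (opp k)"
      using arc_difference[OF x opp_less[OF k]] by (simp add: bit_add_eq_0_iff)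
    moreover have "arc x (opp k) = inside x (opp k)"
      using neq k by (auto simp: arc_def inside_def)
    ultimately show ?thesis
      using 3 by (simp add: crossing_def)
  qed
qed

text \<open>For interlaced \<open>x\<close> and \<open>y\<close>, the occurrence of \<open>x\<close>
  inside the arc of \<open>y\<close> contributes \<open>g x\<close> and the end terms
  \<open>1 + g y\<close>, so the equation is \<open>?N + 1 + g x + g y = 0\<close>. By
  \<open>rosenstiehl_eq\<close> this concerns the Rosenstiehl form, its position parities being
  absorbed by \<open>potential\<close>. For other pairs the equation holds by
  \<open>sum_inside_opp_eq_0\<close>.\<close>

lemma arc_in_sides_iff:
  assumes x: "x \<in> V"
  shows "arc x \<in> sides ` face_functions \<longleftrightarrow>
    (\<forall>y\<in>V. interlaced w x y \<longrightarrow> rosenstiehl V E x y = potential \<phi> (first x) + potential \<phi> (first y))"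
proof -
  define g where "g y = (of_bool (\<phi> (first y) = Infinity) :: bit)" for y
  have cross: "crossing (arc x) k = inside x (opp k) + of_bool (w ! k = x) * g x" if "k < m" for k
    unfolding g_def by (rule crossing_arc[OF x that])
  \<comment> \<open>The additional term of \<open>crossing_arc\<close> is supported on the two
    occurrences of \<open>x\<close>.\<close>
  have letter: "(\<Sum>k<m. f k * (of_bool (w ! k = x) * g x)) = (f (first x) + f (second x)) * g x" for f
  proof -
    have "(\<Sum>k<m. f k * (of_bool (w ! k = x) * g x))
        = (\<Sum>z\<in>V. if z = x then (f (first z) + f (second z)) * g x else 0)"
      unfolding sum_positions by (intro sum.cong) (auto simp: distrib_right)
    then show ?thesis using x by simp
  qed
  \<comment> \<open>The interior of the arc is even and the two occurrences of \<open>x\<close>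
    contribute equally, so the integral always closes up.\<close>
  have total: "(\<Sum>k<m. crossing (arc x) k) = 0"
  proof -
    have "(\<Sum>k<m. crossing (arc x) k) = (\<Sum>k<m. inside x (opp k)) + (\<Sum>k<m. 1 * (of_bool (w ! k = x) * g x))"
      unfolding sum.distrib[symmetric] by (intro sum.cong) (simp_all add: cross)
    then show ?thesis
      unfolding letter sum_opp sum_inside[OF x] by simp
  qed
  have "(\<Sum>k<m. inside y k * crossing (arc x) k)
      + (if \<phi> (first y) = Infinity then 0 else crossing (arc x) (first y) + crossing (arc x) (second y)) = 0
    \<longleftrightarrow> (interlaced w x y \<longrightarrow> rosenstiehl V E x y = potential \<phi> (first x) + potential \<phi> (first y))"
    if y: "y \<in> V" for y
  proof -
    let ?N = "\<Sum>k<m. inside x k * inside y (opp k)"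
    let ?e = "of_bool (interlaced w x y) :: bit"
    have "(\<Sum>k<m. inside y k * crossing (arc x) k)
        = (\<Sum>k<m. inside y k * inside x (opp k)) + (\<Sum>k<m. inside y k * (of_bool (w ! k = x) * g x))"
      unfolding sum.distrib[symmetric] distrib_left[symmetric] by (intro sum.cong) (simp_all add: cross)
    \<comment> \<open>Reindexing by the involution \<open>opp\<close> moves it from \<open>x\<close>
      to \<open>y\<close>.\<close>
    also have "(\<Sum>k<m. inside y k * inside x (opp k)) = (\<Sum>k<m. inside y (opp k) * inside x (opp (opp k)))"
      by (rule sum_opp[symmetric])
    also have "\<dots> = ?N"
      by (intro sum.cong) (simp_all add: mult.commute)
    also have "(\<Sum>k<m. inside y k * (of_bool (w ! k = x) * g x)) = ?e * g x"
      unfolding letter adjacency_eq[OF y x, symmetric] adjacency_eq_of_bool interlaced_sym[of w y x] ..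
    finally have Q: "(\<Sum>k<m. inside y k * crossing (arc x) k) = ?N + ?e * g x" .
    have "crossing (arc x) (first y) + crossing (arc x) (second y) = inside x (second y) + inside x (first y)"
      unfolding cross[OF first_less[OF y]] cross[OF second_less[OF y]] nth_first[OF y] nth_second[OF y]
        opp_first[OF y] opp_second[OF y] by (rule bit_add_cancel_right)
    also have "\<dots> = ?e"
      unfolding adjacency_eq_of_bool[symmetric] adjacency_eq[OF x y] by (rule add.commute)
    finally have R: "crossing (arc x) (first y) + crossing (arc x) (second y) = ?e" .
    have L: "?N + ?e * g x + (if \<phi> (first y) = Infinity then 0 else ?e) = ?N + ?e * (1 + g x + g y)"
      by (cases "interlaced w x y"; cases "g x"; simp add: g_def)
    show ?thesis
    proof (cases "interlaced w x y")
      case True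
      have bits: "a + (1 + b + c) = 0 \<longleftrightarrow> 1 + d + e + a = (b + d) + (c + e)" for a b c d e :: bit
        by (cases a; cases b; cases c; cases d; cases e) simp_all
      show ?thesis
        unfolding Q R L rosenstiehl_eq[OF x y True] potential_def g_def[symmetric]
        using bits True by simp
    next
      case False
      then show ?thesis
        unfolding Q R sum_inside_opp_eq_0[OF x y False] by simp
    qed
  qed
  moreover have "arc x \<in> cycles"
    by (rule arc_in_cycles[OF x])
  ultimately show ?thesis
    by (simp only: sides_image_iff total simp_thms cong: ball_cong)
qed

lemma genus_0_iff_potential:
  "has_genus w \<phi> 0 \<longleftrightarrow>
    (\<forall>x\<in>V. \<forall>y\<in>V. interlaced w x y \<longrightarrow> rosenstiehl V E x y = potential \<phi> (first x) + potential \<phi> (first y))"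
  unfolding genus_0_iff_generators using one_in_sides arc_in_sides_iff by (simp only: simp_thms cong: ball_cong)

end

section \<open>Framings of genus 0\<close>

lemma framingsI:
  assumes "\<phi> \<in> {..<length w} \<rightarrow>\<^sub>E UNIV"
    and "\<And>i j. i < length w \<Longrightarrow> j < length w \<Longrightarrow> i \<noteq> j \<Longrightarrow> w ! i = w ! j \<Longrightarrow> \<phi> i \<noteq> \<phi> j"
  shows "\<phi> \<in> framings w"
  unfolding framings_def using assms by blast

lemma framings_extensional: "\<phi> \<in> framings w \<Longrightarrow> \<phi> \<in> {..<length w} \<rightarrow>\<^sub>E UNIV"
  by (simp add: framings_def)

lemma framingsD:
  "\<phi> \<in> framings w \<Longrightarrow> i < length w \<Longrightarrow> j < length w \<Longrightarrow> i \<noteq> j \<Longrightarrow> w ! i = w ! j \<Longrightarrow> \<phi> i \<noteq> \<phi> j"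
  unfolding framings_def by blast

lemma invert_on_in_framings:
  assumes "\<phi> \<in> framings w"
  shows "invert_on w U \<phi> \<in> framings w"
proof (rule framingsI)
  fix i j assume ij: "i < length w" "j < length w" "i \<noteq> j" "w ! i = w ! j"
  from framingsD[OF assms this] ij show "invert_on w U \<phi> i \<noteq> invert_on w U \<phi> j"
    by (cases "\<phi> i"; cases "\<phi> j") (simp_all add: invert_on_def)
qed (simp add: invert_on_def)

context chord_word
begin

lemma potential_invert_on:
  "i < m \<Longrightarrow> potential (invert_on w U \<phi>) i = potential \<phi> i + of_bool (w ! i \<in> U)"
  by (cases "\<phi> i"; cases "w ! i \<in> U"; cases "of_nat i :: bit") (simp_all add: potential_def invert_on_def)

lemma framings_eqI:
  assumes "\<phi> \<in> framings w" "\<psi> \<in> framings w" "\<And>i. i < m \<Longrightarrow> potential \<phi> i = potential \<psi> i"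
  shows "\<phi> = \<psi>"
proof (rule PiE_ext[OF assms(1,2)[THEN framings_extensional]])
  fix i assume "i \<in> {..<m}"
  with assms(3)[of i] have "of_bool (\<phi> i = Infinity) = (of_bool (\<psi> i = Infinity) :: bit)"
    by (simp add: potential_def)
  then show "\<phi> i = \<psi> i"
    by (cases "\<phi> i"; cases "\<psi> i") simp_all
qed

lemma inj_on_invert_on: "inj_on (\<lambda>U. invert_on w U \<phi>) (Pow V)"
proof (rule inj_onI)
  fix U U' assume U: "U \<in> Pow V" "U' \<in> Pow V" and eq: "invert_on w U \<phi> = invert_on w U' \<phi>"
  have "x \<in> U \<longleftrightarrow> x \<in> U'" if x: "x \<in> V" for x
    using potential_invert_on[OF first_less[OF x], of U \<phi>] potential_invert_on[OF first_less[OF x], of U' \<phi>] x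
    unfolding eq nth_first[OF x] by (simp add: of_bool_eq_iff)
  with U show "U = U'" by blast
qed

end

context even_chord_word
begin

lemma potential_opp:
  assumes "\<phi> \<in> framings w" "i < m"
  shows "potential \<phi> (opp i) = potential \<phi> i"
proof -
  have "of_nat (opp i) = (of_nat i + 1 :: bit)"
  proof -
    have wi: "w ! i \<in> V" using assms(2) by simp
    from position_cases[OF assms(2)] show ?thesis
    proof
      assume i: "i = first (w ! i)"
      have "opp i = second (w ! i)"
        using opp_first[OF wi] by (simp only: i[symmetric])
      then show ?thesis
        using parity_second[OF wi] by (simp only: i[symmetric])
    next
      assume i: "i = second (w ! i)"
      have "opp i = first (w ! i)"
        using opp_second[OF wi] by (simp only: i[symmetric])
      then show ?thesis
        using parity_second[OF wi] by (simp add: i[symmetric] add.assoc)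
    qed
  qed
  moreover have "\<phi> (opp i) \<noteq> \<phi> i"
    using framingsD[OF assms(1) opp_less[OF assms(2)] assms(2)] assms(2) by simp
  ultimately show ?thesis
    unfolding potential_def by (cases "\<phi> i"; cases "\<phi> (opp i)"; cases "of_nat i :: bit") simp_all
qed

lemma potential_first:
  assumes "\<phi> \<in> framings w" "i < m"
  shows "potential \<phi> i = potential \<phi> (first (w ! i))"
proof -
  have wi: "w ! i \<in> V" using assms(2) by simp
  from position_cases[OF assms(2)] show ?thesis
  proof
    assume "i = first (w ! i)"
    then show ?thesis by (rule arg_cong)
  next
    assume i: "i = second (w ! i)"
    then have "opp i = first (w ! i)"
      using opp_second[OF wi] by metis
    with potential_opp[OF assms] show ?thesis by simp
  qed
qed

lemma genus_0_iff:
  assumes "\<phi> \<in> framings w"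
  shows "has_genus w \<phi> 0 \<longleftrightarrow>
    (\<forall>x\<in>V. \<forall>y\<in>V. interlaced w x y \<longrightarrow> rosenstiehl V E x y = potential \<phi> (first x) + potential \<phi> (first y))"
proof (cases "w = []")
  \<comment> \<open>The empty word lies outside \<open>framed_word\<close>; its annulus has two
    boundary components, hence genus 0, and the right-hand side ranges over no letters.\<close>
  case True
  then show ?thesis by (simp add: has_genus_def boundary_components_def)
next
  case False
  then interpret even_framed_word w \<phi>
    by unfold_locales (use assms in auto)
  show ?thesis by (rule genus_0_iff_potential)
qed

text \<open>Two framings of genus 0 have potentials with the same coboundary, so the set of letters
  where these differ is a union of components. Conversely, inverting on such a union changes the
  potential by a locally constant function.\<close>

lemma genus0_framings_eq:
  assumes \<phi>: "\<phi> \<in> genus0_framings w"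
  shows "genus0_framings w = {invert_on w (\<Union>K) \<phi> | K. K \<subseteq> components V E}"
proof (intro equalityI subsetI)
  have F: "\<phi> \<in> framings w" and g\<phi>: "has_genus w \<phi> 0"
    using \<phi> by (auto simp: genus0_framings_def)
  note ros = g\<phi>[unfolded genus_0_iff[OF F], rule_format]
  {
    fix \<psi> assume "\<psi> \<in> genus0_framings w"
    then have G: "\<psi> \<in> framings w" and g\<psi>: "has_genus w \<psi> 0"
      by (auto simp: genus0_framings_def)
    note ros' = g\<psi>[unfolded genus_0_iff[OF G], rule_format]
    define U where "U = {x\<in>V. potential \<psi> (first x) \<noteq> potential \<phi> (first x)}"
    have "x \<in> U \<longleftrightarrow> y \<in> U" if "x \<in> V" "y \<in> V" "{x, y} \<in> E" for x y
    proof -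
      have "interlaced w x y" using that(3) by (simp only: interlace_edges_iff)
      from ros[OF that(1,2) this] ros'[OF that(1,2) this]
      have "potential \<phi> (first x) + potential \<phi> (first y) = potential \<psi> (first x) + potential \<psi> (first y)"
        by (rule trans[OF sym])
      with that(1,2) show ?thesis
        unfolding U_def
        by (cases "potential \<phi> (first x)"; cases "potential \<phi> (first y)";
            cases "potential \<psi> (first x)"; cases "potential \<psi> (first y)") simp_all
    qed
    moreover have "e \<subseteq> V" if "e \<in> E" for e
      using graph_interlace[of w] that unfolding graph_def by auto
    ultimately have "U = \<Union>{K \<in> components V E. K \<subseteq> U}"
      by (intro locally_constant_eq_Union_components) (auto simp: U_def)
    moreover have "\<psi> = invert_on w U \<phi>"
    proof (rule framings_eqI[OF G invert_on_in_framings[OF F]])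
      fix i assume i: "i < m"
      show "potential \<psi> i = potential (invert_on w U \<phi>) i"
        unfolding potential_invert_on[OF i] potential_first[OF F i] potential_first[OF G i]
        using i by (cases "potential \<psi> (first (w ! i))"; cases "potential \<phi> (first (w ! i))") (simp_all add: U_def)
    qed
    ultimately show "\<psi> \<in> {invert_on w (\<Union>K) \<phi> | K. K \<subseteq> components V E}"
      by (intro CollectI exI[of _ "{K \<in> components V E. K \<subseteq> U}"]) auto
  next
    fix \<psi> assume "\<psi> \<in> {invert_on w (\<Union>K) \<phi> | K. K \<subseteq> components V E}"
    then obtain \<K> where K: "\<K> \<subseteq> components V E" "\<psi> = invert_on w (\<Union>\<K>) \<phi>" by blast
    have G: "\<psi> \<in> framings w"
      unfolding K(2) by (rule invert_on_in_framings[OF F])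
    moreover have "has_genus w \<psi> 0"
      unfolding genus_0_iff[OF G]
    proof (intro ballI impI)
      fix x y assume xy: "x \<in> V" "y \<in> V" "interlaced w x y"
      have "x \<in> \<Union>\<K> \<longleftrightarrow> y \<in> \<Union>\<K>"
        using components_adjacent[of _ V E x y] K(1) xy unfolding interlace_edges_iff by blast
      then show "rosenstiehl V E x y = potential \<psi> (first x) + potential \<psi> (first y)"
        unfolding ros[OF xy] K(2) potential_invert_on[OF first_less[OF xy(1)]]
          potential_invert_on[OF first_less[OF xy(2)]] nth_first[OF xy(1)] nth_first[OF xy(2)]
        by (simp only: bit_add_cancel_right)
    qed
    ultimately show "\<psi> \<in> genus0_framings w"
      by (simp add: genus0_framings_def)
  }
qed

text \<open>Distinct sets of components have distinct unions, and inverting on distinct sets of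
  letters gives distinct framings.\<close>

lemma card_genus0_framings:
  assumes "\<phi> \<in> genus0_framings w"
  shows "card (genus0_framings w) = 2 ^ card (components V E)"
proof -
  have "genus0_framings w = (\<lambda>U. invert_on w U \<phi>) ` Union ` Pow (components V E)"
    unfolding genus0_framings_eq[OF assms] by blast
  moreover have "Union ` Pow (components V E) \<subseteq> Pow V"
    using Union_components[of V E] by blast
  ultimately have "card (genus0_framings w) = card (Union ` Pow (components V E))"
    by (simp add: card_image inj_on_subset[OF inj_on_invert_on])
  also have "\<dots> = card (Pow (components V E))"
    by (rule card_image[OF inj_on_Union_components])
  finally show ?thesis
    by (simp add: card_Pow finite_components)
qed

section \<open>Framings obtained from a colouring\<close>

definition colour_bit :: "colour \<Rightarrow> bit" where
  "colour_bit k = of_bool (k = White)"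

lemma colour_bit_neq_iff: "k \<noteq> l \<longleftrightarrow> colour_bit k + colour_bit l = 1"
  by (cases k; cases l) (simp_all add: colour_bit_def)

text \<open>Consecutive positions have opposite parities, also across the end of the word because
  its length is even, so equal frames mean different potentials.\<close>

lemma same_frame_iff:
  assumes "i < m"
  shows "\<phi> i = \<phi> (Suc i mod m) \<longleftrightarrow> potential \<phi> i + potential \<phi> (Suc i mod m) = 1"
proof -
  have "of_nat (Suc i mod m) = (of_nat i + 1 :: bit)"
    using even_length dvd_mod_iff[of 2 m "Suc i"] by (simp add: of_nat_bit)
  then show ?thesis
    unfolding potential_def
    by (cases "\<phi> i"; cases "\<phi> (Suc i mod m)"; cases "of_nat i :: bit") simp_all
qed

text \<open>The condition on consecutive letters says that potential plus colour does not change
  from one position to the next. The word is a single cycle, so one constant \<open>b\<close> serves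
  all components.\<close>

lemma framings_from_colouring_iff:
  assumes \<phi>: "\<phi> \<in> framings w"
  shows "\<phi> \<in> framings_from_colouring w \<chi> \<longleftrightarrow> (\<exists>b. \<forall>i<m. potential \<phi> i = colour_bit (\<chi> (w ! i)) + b)"
proof -
  let ?c = "\<lambda>i. colour_bit (\<chi> (w ! i))"
  have "\<phi> \<in> framings_from_colouring w \<chi> \<longleftrightarrow>
      (\<forall>i<m. potential \<phi> i + potential \<phi> (Suc i mod m) = 1 \<longleftrightarrow> ?c i + ?c (Suc i mod m) = 1)"
    using \<phi> same_frame_iff unfolding framings_from_colouring_def colour_bit_neq_iff by blast
  also have "\<dots> \<longleftrightarrow> (\<forall>i<m. potential \<phi> i + ?c i = potential \<phi> (Suc i mod m) + ?c (Suc i mod m))"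
  proof -
    have "(a + b = 1 \<longleftrightarrow> c + d = 1) \<longleftrightarrow> a + c = b + d" for a b c d :: bit
      by (cases a; cases b; cases c; cases d) simp_all
    then show ?thesis by (simp only:)
  qed
  also have "\<dots> \<longleftrightarrow> (\<exists>b. \<forall>i<m. potential \<phi> i = ?c i + b)"
  proof
    assume step: "\<forall>i<m. potential \<phi> i + ?c i = potential \<phi> (Suc i mod m) + ?c (Suc i mod m)"
    have "potential \<phi> i + ?c i = potential \<phi> 0 + ?c 0" if "i < m" for i
      using that
    proof (induction i)
      case (Suc i)
      then have "potential \<phi> (Suc i) + ?c (Suc i) = potential \<phi> i + ?c i"
        using step[rule_format, of i] unfolding mod_less[OF Suc.prems] by simp
      also have "\<dots> = potential \<phi> 0 + ?c 0"
        using Suc by simp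
      finally show ?case .
    qed simp
    then have "potential \<phi> i = ?c i + (potential \<phi> 0 + ?c 0)" if "i < m" for i
      using that bit_add_left_self[of "?c i" "potential \<phi> i"] by (metis add.commute)
    then show "\<exists>b. \<forall>i<m. potential \<phi> i = ?c i + b" by blast
  next
    assume "\<exists>b. \<forall>i<m. potential \<phi> i = ?c i + b"
    then obtain b where b: "\<And>i. i < m \<Longrightarrow> potential \<phi> i = ?c i + b" by blast
    have "potential \<phi> i + ?c i = b" if "i < m" for i
      unfolding b[OF that] by (simp add: add.commute)
    moreover have "Suc i mod m < m" if "i < m" for i
      using that by (intro mod_less_divisor) linarith
    ultimately show "\<forall>i<m. potential \<phi> i + ?c i = potential \<phi> (Suc i mod m) + ?c (Suc i mod m)"
      by simp
  qed
  finally show ?thesis .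
qed

text \<open>The equation between potential and colour is solved for the frame at each position; the
  two occurrences of a letter receive different frames because their positions have opposite
  parities.\<close>

lemma exists_framing_of_colouring:
  obtains \<phi> where "\<phi> \<in> framings w" "\<And>i. i < m \<Longrightarrow> potential \<phi> i = colour_bit (\<chi> (w ! i))"
proof -
  define \<phi> where "\<phi> = (\<lambda>i\<in>{..<m}. if colour_bit (\<chi> (w ! i)) + of_nat i = 1 then Infinity else Zero)"
  have pot: "potential \<phi> i = colour_bit (\<chi> (w ! i))" if "i < m" for i
    using that by (cases "colour_bit (\<chi> (w ! i))"; cases "of_nat i :: bit") (simp_all add: potential_def \<phi>_def)
  have "\<phi> \<in> framings w"
  proof (rule framingsI)
    fix i j assume ij: "i < m" "j < m" "i \<noteq> j" "w ! i = w ! j"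
    then have "j = opp i" using same_letter[of i j] by simp
    have "of_nat i \<noteq> (of_nat j :: bit)"
    proof -
      have wi: "w ! i \<in> V" using ij by simp
      have "{i, j} = {first (w ! i), second (w ! i)}"
        using position_cases[OF ij(1)] position_cases[OF ij(2)] ij(3,4) by (metis insert_commute)
      with parity_second[OF wi] show ?thesis
        by (auto simp: doubleton_eq_iff)
    qed
    then show "\<phi> i \<noteq> \<phi> j"
      using ij by (cases "of_nat i :: bit"; cases "of_nat j :: bit"; cases "colour_bit (\<chi> (w ! j))")
        (simp_all add: \<phi>_def)
  qed (simp add: \<phi>_def)
  with pot that show thesis by blast
qed

text \<open>The two values of the constant \<open>b\<close> give the two framings, since adding 1 to
  the potential inverts every frame. On the empty word they coincide.\<close>

lemma framings_from_colouring_eq: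
  "\<exists>\<phi>. framings_from_colouring w \<chi> = {\<phi>, invert_on w V \<phi>} \<and> (w \<noteq> [] \<longrightarrow> invert_on w V \<phi> \<noteq> \<phi>)"
proof -
  obtain \<phi> where F: "\<phi> \<in> framings w" and pot: "\<And>i. i < m \<Longrightarrow> potential \<phi> i = colour_bit (\<chi> (w ! i))"
    using exists_framing_of_colouring[of \<chi>] by blast
  let ?\<phi>' = "invert_on w V \<phi>"
  have F': "?\<phi>' \<in> framings w" by (rule invert_on_in_framings[OF F])
  have pot': "potential ?\<phi>' i = colour_bit (\<chi> (w ! i)) + 1" if "i < m" for i
    unfolding potential_invert_on[OF that] pot[OF that] using that by simp
  have "framings_from_colouring w \<chi> = {\<phi>, ?\<phi>'}"
  proof (intro equalityI subsetI)
    fix \<psi> assume \<psi>: "\<psi> \<in> framings_from_colouring w \<chi>"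
    then have G: "\<psi> \<in> framings w" by (simp add: framings_from_colouring_def)
    with \<psi> obtain b where b: "\<And>i. i < m \<Longrightarrow> potential \<psi> i = colour_bit (\<chi> (w ! i)) + b"
      unfolding framings_from_colouring_iff[OF G] by blast
    show "\<psi> \<in> {\<phi>, ?\<phi>'}"
    proof (cases b)
      case zero
      have "\<psi> = \<phi>"
        by (rule framings_eqI[OF G F]) (simp add: b pot zero)
      then show ?thesis by simp
    next
      case one
      have "\<psi> = ?\<phi>'"
        by (rule framings_eqI[OF G F']) (simp add: b pot' one)
      then show ?thesis by simp
    qed
  next
    fix \<psi> assume "\<psi> \<in> {\<phi>, ?\<phi>'}"
    then show "\<psi> \<in> framings_from_colouring w \<chi>"
    proof (elim insertE emptyE)
      assume "\<psi> = \<phi>"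
      then show ?thesis
        unfolding \<open>\<psi> = \<phi>\<close> framings_from_colouring_iff[OF F] by (intro exI[of _ 0] allI impI) (simp add: pot)
    next
      assume "\<psi> = ?\<phi>'"
      show ?thesis
        unfolding \<open>\<psi> = ?\<phi>'\<close> framings_from_colouring_iff[OF F'] by (intro exI[of _ 1] allI impI) (rule pot')
    qed
  qed
  moreover have "?\<phi>' \<noteq> \<phi>" if "w \<noteq> []"
  proof
    assume "?\<phi>' = \<phi>"
    with pot[of 0] pot'[of 0] that show False by simp
  qed
  ultimately show ?thesis by blast
qed

text \<open>On an edge the constant \<open>b\<close> cancels, so the potential has the same
  coboundary as the colouring, namely the Rosenstiehl form.\<close>

lemma framings_from_colouring_genus_0:
  assumes \<chi>: "integrates_rosenstiehl V E \<chi>"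
  shows "framings_from_colouring w \<chi> \<subseteq> genus0_framings w"
proof
  fix \<phi> assume \<phi>: "\<phi> \<in> framings_from_colouring w \<chi>"
  then have F: "\<phi> \<in> framings w" by (simp add: framings_from_colouring_def)
  with \<phi> obtain b where b: "\<And>i. i < m \<Longrightarrow> potential \<phi> i = colour_bit (\<chi> (w ! i)) + b"
    unfolding framings_from_colouring_iff[OF F] by blast
  have "has_genus w \<phi> 0"
    unfolding genus_0_iff[OF F]
  proof (intro ballI impI)
    fix x y assume xy: "x \<in> V" "y \<in> V" "interlaced w x y"
    have "colour_bit (\<chi> x) + colour_bit (\<chi> y) = 1 \<longleftrightarrow> rosenstiehl V E x y = 1"
      using \<chi> xy unfolding integrates_rosenstiehl_def interlace_edges_iff colour_bit_neq_iff by blast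
    then have "rosenstiehl V E x y = colour_bit (\<chi> x) + colour_bit (\<chi> y)"
      by (cases "rosenstiehl V E x y"; cases "colour_bit (\<chi> x) + colour_bit (\<chi> y)") simp_all
    then show "rosenstiehl V E x y = potential \<phi> (first x) + potential \<phi> (first y)"
      unfolding b[OF first_less[OF xy(1)]] b[OF first_less[OF xy(2)]] nth_first[OF xy(1)] nth_first[OF xy(2)]
      by (simp only: bit_add_cancel_right)
  qed
  with F show "\<phi> \<in> genus0_framings w"
    by (simp add: genus0_framings_def)
qed

end

lemma coboundary_imp_colouring:
  assumes "is_coboundary V E (rosenstiehl V E)"
  shows "\<exists>\<chi>. integrates_rosenstiehl V E \<chi>"
proof -
  obtain f where f: "\<And>x y. x \<in> V \<Longrightarrow> y \<in> V \<Longrightarrow> {x, y} \<in> E \<Longrightarrow> rosenstiehl V E x y = f x + f y"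
    using assms unfolding is_coboundary_def by blast
  have "(if f x = 1 then White else Black) \<noteq> (if f y = 1 then White else Black) \<longleftrightarrow> f x + f y = 1" for x y
    by (cases "f x"; cases "f y") simp_all
  then have "integrates_rosenstiehl V E (\<lambda>x. if f x = 1 then White else Black)"
    unfolding integrates_rosenstiehl_def using f by simp
  then show ?thesis by blast
qed

theorem corollary1p3:
  fixes w :: "'a list" and V :: "'a set" and E :: "'a set set"
  defines "V \<equiv> set w" and "E \<equiv> interlace_edges w"
  assumes "chord_diagram w" and "gaussian V E"
  shows "card (genus0_framings w) = card (H0 V E) \<and>
     card (H0 V E) = 2 ^ card (components V E) \<and>
     (\<exists>\<chi>. integrates_rosenstiehl V E \<chi>) \<and>
     (\<forall>\<chi>. integrates_rosenstiehl V E \<chi> \<longrightarrow>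
        (\<exists>\<phi>. framings_from_colouring w \<chi> = {\<phi>, invert_on w V \<phi>} \<and>
             (w \<noteq> [] \<longrightarrow> invert_on w V \<phi> \<noteq> \<phi>)) \<and>
        framings_from_colouring w \<chi> \<subseteq> genus0_framings w \<and>
        (\<forall>\<phi>\<in>framings_from_colouring w \<chi>.
           genus0_framings w = {invert_on w (\<Union>K) \<phi> | K. K \<subseteq> components V E}))"
proof -
  interpret even_chord_word w
    using assms by (intro even_chord_wordI) (simp_all only: V_def E_def)
  have H0: "card (H0 V E) = 2 ^ card (components V E)"
    unfolding V_def E_def by (rule card_H0[OF graph_interlace])
  have ex: "\<exists>\<chi>. integrates_rosenstiehl V E \<chi>"
    using assms(4) by (intro coboundary_imp_colouring) (simp add: gaussian_def)
  have sub: "framings_from_colouring w \<chi> \<subseteq> genus0_framings w" if "integrates_rosenstiehl V E \<chi>" for \<chi>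
    using that unfolding V_def E_def by (rule framings_from_colouring_genus_0)
  have "card (genus0_framings w) = card (H0 V E)"
  proof -
    \<comment> \<open>The count is relative to one given framing of genus 0; a colouring provides
      it.\<close>
    obtain \<chi> where "integrates_rosenstiehl V E \<chi>" using ex by blast
    from sub[OF this] framings_from_colouring_eq[of \<chi>] obtain \<phi> where "\<phi> \<in> genus0_framings w"
      by blast
    from card_genus0_framings[OF this] show ?thesis
      unfolding H0 by (simp only: V_def E_def)
  qed
  moreover have "\<exists>\<phi>. framings_from_colouring w \<chi> = {\<phi>, invert_on w V \<phi>} \<and>
      (w \<noteq> [] \<longrightarrow> invert_on w V \<phi> \<noteq> \<phi>)" for \<chi>
    unfolding V_def by (rule framings_from_colouring_eq)
  moreover have "genus0_framings w = {invert_on w (\<Union>K) \<phi> | K. K \<subseteq> components V E}"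
    if "integrates_rosenstiehl V E \<chi>" "\<phi> \<in> framings_from_colouring w \<chi>" for \<chi> \<phi>
    unfolding V_def E_def using sub that by (intro genus0_framings_eq) blast
  ultimately show ?thesis
    using H0 ex sub by (intro conjI allI impI ballI)
qed

end
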